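(* Let $\Gamma\in\mathscr G_3$ have coherent rank $8$. Then (for a suitable ordering of the vertices) the adjacency matrix of $\Gamma$ has the form $$\begin{bmatrix} O & M\\ M^\top & J-I\end{bmatrix},$$ where $M$ is the incidence matrix of a symmetric $2$-$(\lambda^3-\lambda+1,\lambda^2,\lambda)$ design for some $\lambda\in\mathbb N$.
   Context: All graphs are finite, undirected and simple; the eigenvalues of a graph are those of its adjacency matrix $A(\Gamma)$. $\mathscr G_3$ denotes the set of all connected graphs having precisely three distinct eigenvalues. $I$, $J$, $O$ denote the identity, all-ones and zero matrices of appropriate size. A coherent algebra on a finite set $X$ is a matrix algebra $\mathcal A\subset \operatorname{Mat}_X(\mathbb C)$ that contains $I$ and $J$, and is closed under transposition, ordinary matrix multiplication and entrywise multiplication. Each coherent algebra has a unique linear basis consisting of $\{0,1\}$-matrices whose sum is $J$; the number of these matrices is the rank of $\mathcal A$. The coherent closure $\mathcal W(\Gamma)$ of $\Gamma$ is the smallest coherent algebra containing $A(\Gamma)$, and the coherent rank of $\Gamma$ is the rank of $\mathcal W(\Gamma)$. A $2$-$(v,k,\lambda)$ design is a pair $(\mathcal P,\mathcal B)$ with $|\mathcal P|=v$ points and a family $\mathcal B$ of $k$-subsets of $\mathcal P$ (blocks) such that every pair of distinct points lies in precisely $\lambda$ blocks. It is symmetric if every two blocks intersect in a constant number of points (so the number of blocks equals $v$). The incidence matrix has rows indexed by points, columns indexed by blocks, and $(i,j)$-entry $1$ if $i\in j$ and $0$ otherwise. *)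

theory Defs
  imports "HOL-Analysis.Analysis"
begin

section \<open>Graphs with three distinct eigenvalues\<close>

text \<open>
  A graph is given by its adjacency relation; the vertex set is the finite type
  \<open>'v\<close>, so that \<open>complex ^ 'v ^ 'v\<close> is the matrix algebra \<open>Mat_X(C)\<close> for \<open>X\<close> the
  set of vertices.
\<close>

definition simple_graph :: "('v::finite \<Rightarrow> 'v \<Rightarrow> bool) \<Rightarrow> bool" where
  "simple_graph E \<longleftrightarrow> symp E \<and> irreflp E"

definition connected_graph :: "('v::finite \<Rightarrow> 'v \<Rightarrow> bool) \<Rightarrow> bool" where
  "connected_graph E \<longleftrightarrow> (\<forall>u v. rtranclp E u v)"

definition adjacency_matrix :: "('v::finite \<Rightarrow> 'v \<Rightarrow> bool) \<Rightarrow> complex ^ 'v ^ 'v" where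
  "adjacency_matrix E = (\<chi> u v. if E u v then 1 else 0)"

definition eigenvalues :: "complex ^ 'v ^ 'v \<Rightarrow> complex set" where
  "eigenvalues A = {c. \<exists>x. x \<noteq> 0 \<and> A *v x = c *s x}"

definition G3 :: "('v::finite \<Rightarrow> 'v \<Rightarrow> bool) set" where
  "G3 = {E. simple_graph E \<and> connected_graph E \<and> card (eigenvalues (adjacency_matrix E)) = 3}"


section \<open>Coherent algebras\<close>

definition all_ones :: "complex ^ 'v ^ 'v" where
  "all_ones = (\<chi> i j. 1)"

definition entrywise_mult :: "complex ^ 'v ^ 'v \<Rightarrow> complex ^ 'v ^ 'v \<Rightarrow> complex ^ 'v ^ 'v" where
  "entrywise_mult A B = (\<chi> i j. A $ i $ j * B $ i $ j)"

definition cscale :: "complex \<Rightarrow> complex ^ 'v ^ 'v \<Rightarrow> complex ^ 'v ^ 'v" where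
  "cscale c A = (\<chi> i j. c * A $ i $ j)"

text \<open>
  The type class structure on matrices only provides real scalars; this makes the
  library's \<open>subspace\<close>, \<open>span\<close> and \<open>independent\<close> available over the complex numbers.
\<close>

global_interpretation cmat: vector_space "cscale :: complex \<Rightarrow> complex ^ 'v ^ 'v \<Rightarrow> complex ^ 'v ^ 'v"
  by unfold_locales (simp_all add: cscale_def vec_eq_iff algebra_simps)

definition coherent_algebra :: "(complex ^ 'v ^ 'v) set \<Rightarrow> bool" where
  "coherent_algebra \<A> \<longleftrightarrow>
     cmat.subspace \<A> \<and> mat 1 \<in> \<A> \<and> all_ones \<in> \<A> \<and>
     (\<forall>A\<in>\<A>. transpose A \<in> \<A>) \<and>
     (\<forall>A\<in>\<A>. \<forall>B\<in>\<A>. A ** B \<in> \<A>) \<and>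
     (\<forall>A\<in>\<A>. \<forall>B\<in>\<A>. entrywise_mult A B \<in> \<A>)"

definition is_standard_basis ::
    "(complex ^ 'v ^ 'v) set \<Rightarrow> (complex ^ 'v ^ 'v) set \<Rightarrow> bool" where
  "is_standard_basis \<A> \<B> \<longleftrightarrow>
     \<B> \<subseteq> \<A> \<and> cmat.independent \<B> \<and> cmat.span \<B> = \<A> \<and>
     (\<forall>B\<in>\<B>. \<forall>i j. B $ i $ j \<in> {0, 1}) \<and> finite \<B> \<and> \<Sum>\<B> = all_ones"

definition standard_basis :: "(complex ^ 'v ^ 'v) set \<Rightarrow> (complex ^ 'v ^ 'v) set" where
  "standard_basis \<A> = (THE \<B>. is_standard_basis \<A> \<B>)"

definition algebra_rank :: "(complex ^ 'v ^ 'v) set \<Rightarrow> nat" where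
  "algebra_rank \<A> = card (standard_basis \<A>)"

definition coherent_closure :: "('v::finite \<Rightarrow> 'v \<Rightarrow> bool) \<Rightarrow> (complex ^ 'v ^ 'v) set" where
  "coherent_closure E = \<Inter>{\<A>. coherent_algebra \<A> \<and> adjacency_matrix E \<in> \<A>}"

lemma coherent_algebra_coherent_closure:
  "coherent_algebra (coherent_closure E)" "adjacency_matrix E \<in> coherent_closure E"
  unfolding coherent_closure_def coherent_algebra_def cmat.subspace_def by auto

lemma coherent_closure_least:
  "coherent_algebra \<A> \<Longrightarrow> adjacency_matrix E \<in> \<A> \<Longrightarrow> coherent_closure E \<subseteq> \<A>"
  unfolding coherent_closure_def by auto

definition coherent_rank :: "('v::finite \<Rightarrow> 'v \<Rightarrow> bool) \<Rightarrow> nat" where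
  "coherent_rank E = algebra_rank (coherent_closure E)"


section \<open>Designs\<close>

definition two_design :: "'p set \<Rightarrow> 'p set set \<Rightarrow> nat \<Rightarrow> nat \<Rightarrow> nat \<Rightarrow> bool" where
  "two_design P \<B> v k l \<longleftrightarrow>
     finite P \<and> card P = v \<and>
     (\<forall>B\<in>\<B>. B \<subseteq> P \<and> card B = k) \<and>
     (\<forall>x\<in>P. \<forall>y\<in>P. x \<noteq> y \<longrightarrow> card {B\<in>\<B>. x \<in> B \<and> y \<in> B} = l)"

text \<open>
  The number of blocks is required to be \<open>v\<close> explicitly: the constant intersection
  property yields this only for nondegenerate parameters.
\<close>

definition symmetric_two_design :: "'p set \<Rightarrow> 'p set set \<Rightarrow> nat \<Rightarrow> nat \<Rightarrow> nat \<Rightarrow> bool" where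
  "symmetric_two_design P \<B> v k l \<longleftrightarrow>
     two_design P \<B> v k l \<and> card \<B> = v \<and>
     (\<exists>m. \<forall>B\<in>\<B>. \<forall>C\<in>\<B>. B \<noteq> C \<longrightarrow> card (B \<inter> C) = m)"

text \<open>
  Matrices whose rows and columns are indexed by the elements of arbitrary sets, such as
  points and blocks, are functions of the two indices. A matrix with two
  row blocks and two column blocks is indexed by disjoint sums.
\<close>

definition incidence_matrix :: "'p \<Rightarrow> 'p set \<Rightarrow> complex" where
  "incidence_matrix i j = (if i \<in> j then 1 else 0)"

fun block_matrix ::
    "('a \<Rightarrow> 'c \<Rightarrow> 'x) \<Rightarrow> ('a \<Rightarrow> 'd \<Rightarrow> 'x) \<Rightarrow> ('b \<Rightarrow> 'c \<Rightarrow> 'x) \<Rightarrow> ('b \<Rightarrow> 'd \<Rightarrow> 'x) \<Rightarrow>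
     'a + 'b \<Rightarrow> 'c + 'd \<Rightarrow> 'x" where
  "block_matrix A B C D (Inl i) (Inl j) = A i j"
| "block_matrix A B C D (Inl i) (Inr j) = B i j"
| "block_matrix A B C D (Inr i) (Inl j) = C i j"
| "block_matrix A B C D (Inr i) (Inr j) = D i j"

end

theory Submission
  imports Defs
begin

text \<open>
  Let \<open>A\<close> be the adjacency matrix. By the spectral theorem and the Perron-Frobenius theorem,
  having three eigenvalues means that \<open>A\<^sup>2 = s A - q I + \<alpha> \<alpha>\<^sup>T\<close> with \<open>\<alpha>\<close> a positive vector
  (\<open>three_eigenvalues_quadratic\<close>); the entry of \<open>\<alpha>\<close> at a vertex is determined by its degree.

  The rank of a coherent algebra is the number of classes into which it divides the pairs of
  vertices (\<open>algebra_rank_eq_card_colour_classes\<close>). A regular graph satisfying the equation has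
  rank at most 3, and three fibres (classes of diagonal pairs) would need rank at least 9, so
  there are exactly two fibres, with different degrees. Let \<open>N\<close> be the block of \<open>A\<close> between them.

  If \<open>N = J\<close>, then rank 8 forces edges and nonedges inside both fibres, and the equation makes the
  degrees equal (\<open>join_imp_same_weight\<close>), a contradiction. As the graph is connected, \<open>N\<close> is not \<open>O\<close>
  either; as its row and column sums are constant, no fibre is a single vertex. So each of the four
  blocks contributes at least two classes, hence exactly two, and the fibres are cliques or
  independent sets. Then \<open>N N\<^sup>T\<close> and \<open>N\<^sup>T N\<close> are combinations of \<open>I\<close> and \<open>J\<close>, and the equation shows that the fibres have the same size, that one is a clique and the
  other independent, and that \<open>N\<close> is the incidence matrix of a symmetric design with the stated
  parameters (\<open>uniform_blocks_imp_design\<close>).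
\<close>

section \<open>Eigenvectors of self-adjoint operators\<close>

lemma quadratic_nonneg_imp_zero:
  fixes b c :: real
  assumes "\<And>t. 0 \<le> 2 * t * b + t\<^sup>2 * c"
  shows "b = 0"
proof (rule ccontr)
  assume "b \<noteq> 0"
  have c: "0 \<le> c" using assms[of 1] assms[of "-1"] by simp
  define t where "t = - b / (c + 1)"
  have t: "t * (c + 1) = - b" using c by (simp add: t_def)
  have "(2 * t * b + t\<^sup>2 * c) * (c + 1)\<^sup>2
      = 2 * (t * (c + 1)) * b * (c + 1) + (t * (c + 1))\<^sup>2 * c"
    by (simp add: power2_eq_square algebra_simps)
  also have "\<dots> = - (b\<^sup>2 * (c + 2))"
    unfolding t by (simp add: power2_eq_square algebra_simps)
  also have "\<dots> < 0" using c \<open>b \<noteq> 0\<close> by simp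
  finally show False using assms[of t] by (simp add: mult_less_0_iff)
qed

text \<open>
  A vector of an invariant subspace \<open>S\<close> at which the Rayleigh quotient attains its upper bound \<open>m\<close>
  on \<open>S\<close> is an eigenvector: the form \<open>m (x \<bullet> x) - x \<bullet> f x\<close> is positive semidefinite on \<open>S\<close>, and \<open>u\<close>
  is a zero of it, so perturbing \<open>u\<close> along \<open>m u - f u \<in> S\<close> has no first-order effect.
\<close>

lemma Rayleigh_max_imp_eigenvector:
  fixes f :: "'a::real_inner \<Rightarrow> 'a"
  assumes lin: "linear f" and sym: "\<And>x y. f x \<bullet> y = x \<bullet> f y"
    and S: "subspace S" "\<And>x. x \<in> S \<Longrightarrow> f x \<in> S"
    and max: "\<And>x. x \<in> S \<Longrightarrow> x \<bullet> f x \<le> m * (x \<bullet> x)"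
    and u: "u \<in> S" "u \<bullet> f u = m * (u \<bullet> u)"
  shows "f u = m *\<^sub>R u"
proof -
  define v where "v = m *\<^sub>R u - f u"
  have v: "v \<in> S" using S u unfolding v_def by (intro subspace_diff subspace_scale) auto
  have "0 \<le> 2 * t * (v \<bullet> v) + t\<^sup>2 * (m * (v \<bullet> v) - v \<bullet> f v)" for t
  proof -
    have "u + t *\<^sub>R v \<in> S" using S u v by (intro subspace_add subspace_scale) auto
    from max[OF this] have
      "0 \<le> m * ((u + t *\<^sub>R v) \<bullet> (u + t *\<^sub>R v)) - (u + t *\<^sub>R v) \<bullet> f (u + t *\<^sub>R v)" by simp
    also have "\<dots> = (m * (u \<bullet> u) - u \<bullet> f u) + 2 * t * ((m *\<^sub>R u - f u) \<bullet> v)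
        + t\<^sup>2 * (m * (v \<bullet> v) - v \<bullet> f v)"
      using sym[of v u] sym[of u v]
      by (simp add: linear_add[OF lin] linear_scale[OF lin] inner_add inner_diff inner_commute
          power2_eq_square algebra_simps)
    finally show ?thesis using u unfolding v_def by simp
  qed
  from quadratic_nonneg_imp_zero[OF this] show ?thesis by (simp add: v_def)
qed

lemma self_adjoint_max_eigenvector:
  fixes f :: "'a::euclidean_space \<Rightarrow> 'a"
  assumes lin: "linear f" and sym: "\<And>x y. f x \<bullet> y = x \<bullet> f y"
    and S: "subspace S" "\<And>x. x \<in> S \<Longrightarrow> f x \<in> S" and x0: "x0 \<in> S" "x0 \<noteq> 0"
  obtains m u where "u \<in> S" "u \<noteq> 0" "f u = m *\<^sub>R u" "\<And>x. x \<in> S \<Longrightarrow> x \<bullet> f x \<le> m * (x \<bullet> x)"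
proof -
  let ?K = "S \<inter> sphere 0 1"
  have "compact ?K" using closed_subspace[OF S(1)] by (simp add: closed_Int_compact)
  moreover have "x0 /\<^sub>R norm x0 \<in> ?K" using x0 S(1) by (auto intro: subspace_scale)
  moreover have "continuous_on ?K (\<lambda>x. x \<bullet> f x)"
    by (intro continuous_intros linear_continuous_on_compose[OF _ lin])
  ultimately obtain u where u: "u \<in> ?K" and le: "\<And>x. x \<in> ?K \<Longrightarrow> x \<bullet> f x \<le> u \<bullet> f u"
    using continuous_attains_sup[of ?K "\<lambda>x. x \<bullet> f x"] by blast
  have max: "x \<bullet> f x \<le> (u \<bullet> f u) * (x \<bullet> x)" if "x \<in> S" for x
  proof (cases "x = 0")
    case False
    have "x /\<^sub>R norm x \<in> ?K" using False that S(1) by (auto intro: subspace_scale)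
    from le[OF this] show ?thesis
      using False by (simp add: linear_scale[OF lin] dot_square_norm field_simps power2_eq_square)
  qed simp
  have "u \<bullet> u = 1" using u by (simp add: dot_square_norm)
  then have "f u = (u \<bullet> f u) *\<^sub>R u"
    using Rayleigh_max_imp_eigenvector[OF lin sym S max, of u] u by simp
  with max u show thesis by (intro that[of u "u \<bullet> f u"]) auto
qed

lemma self_adjoint_eigenvectors_span:
  fixes f :: "'a::euclidean_space \<Rightarrow> 'a"
  assumes lin: "linear f" and sym: "\<And>x y. f x \<bullet> y = x \<bullet> f y"
  shows "span {x. \<exists>c. f x = c *\<^sub>R x} = UNIV"
proof (rule ccontr)
  let ?Eig = "{x. \<exists>c. f x = c *\<^sub>R x}"
  define S where "S = {x. \<forall>y\<in>?Eig. x \<bullet> y = 0}"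
  assume "span ?Eig \<noteq> UNIV"
  then obtain a where "a \<noteq> 0" "\<forall>x\<in>span ?Eig. a \<bullet> x = 0"
    using span_not_UNIV_orthogonal by blast
  then have a: "a \<in> S" "a \<noteq> 0" by (auto simp: S_def span_base)
  have sub: "subspace S" by (auto simp: S_def subspace_def inner_add_left)
  have inv: "f x \<in> S" if "x \<in> S" for x
    using that by (auto simp: S_def sym)
  obtain m u where "u \<in> S" "u \<noteq> 0" "f u = m *\<^sub>R u"
    using self_adjoint_max_eigenvector[OF lin sym sub inv a] by metis
  then have "u \<bullet> u = 0" by (auto simp: S_def)
  with \<open>u \<noteq> 0\<close> show False by simp
qed

section \<open>The quadratic equation of a graph with three eigenvalues\<close>

text \<open>
  The real adjacency matrix as a function of two vertices, and the linear operator on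
  \<open>real ^ 'v\<close> that it defines. Working over the reals gives access to the order; the complex
  eigenvalues of the adjacency matrix are all real.
\<close>

definition adj :: "('v \<Rightarrow> 'v \<Rightarrow> bool) \<Rightarrow> 'v \<Rightarrow> 'v \<Rightarrow> real" where
  "adj E i j = (if E i j then 1 else 0)"

definition adj_map :: "('v::finite \<Rightarrow> 'v \<Rightarrow> bool) \<Rightarrow> real ^ 'v \<Rightarrow> real ^ 'v" where
  "adj_map E x = (\<chi> i. \<Sum>j\<in>UNIV. adj E i j * x $ j)"

lemma adj_sym: "simple_graph E \<Longrightarrow> adj E i j = adj E j i"
  by (auto simp: adj_def simple_graph_def dest: sympD)

lemma linear_adj_map: "linear (adj_map E)"
  by (rule linearI) (simp_all add: adj_map_def vec_eq_iff sum.distrib sum_distrib_left algebra_simps)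

lemma adj_map_sym:
  assumes "simple_graph E"
  shows "adj_map E x \<bullet> y = x \<bullet> adj_map E y"
proof -
  have "adj_map E x \<bullet> y = (\<Sum>i\<in>UNIV. \<Sum>j\<in>UNIV. adj E i j * x $ j * y $ i)"
    by (simp add: inner_vec_def adj_map_def sum_distrib_right)
  also have "\<dots> = (\<Sum>j\<in>UNIV. \<Sum>i\<in>UNIV. adj E i j * x $ j * y $ i)" by (rule sum.swap)
  also have "\<dots> = x \<bullet> adj_map E y"
    by (simp add: inner_vec_def adj_map_def sum_distrib_left adj_sym[OF assms] mult_ac)
  finally show ?thesis .
qed

lemma eigenvalues_adjacency_matrix:
  fixes E :: "'v::finite \<Rightarrow> 'v \<Rightarrow> bool"
  assumes "simple_graph E"
  shows "eigenvalues (adjacency_matrix E) = complex_of_real ` {c. \<exists>x. x \<noteq> 0 \<and> adj_map E x = c *\<^sub>R x}"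
    (is "?L = of_real ` ?R")
proof
  show "of_real ` ?R \<subseteq> ?L"
  proof
    fix z :: complex assume "z \<in> of_real ` ?R"
    then obtain c x where z: "z = of_real c" and x: "x \<noteq> 0" "adj_map E x = c *\<^sub>R x" by auto
    define y :: "complex ^ 'v" where "y = (\<chi> i. of_real (x $ i))"
    have "y \<noteq> 0" using x by (auto simp: y_def vec_eq_iff)
    moreover have "adjacency_matrix E *v y = z *s y"
    proof (subst vec_eq_iff, intro allI)
      fix i
      have "(\<Sum>j\<in>UNIV. adj E i j * x $ j) = c * x $ i"
        using x(2) by (simp add: adj_map_def vec_eq_iff)
      then have "(\<Sum>j\<in>UNIV. of_real (adj E i j * x $ j)) = (of_real (c * x $ i) :: complex)"
        by (metis of_real_sum)
      moreover have "(if E i j then 1 else 0) * y $ j = of_real (adj E i j * x $ j)" for j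
        by (simp add: adj_def y_def)
      ultimately show "(adjacency_matrix E *v y) $ i = (z *s y) $ i"
        by (simp add: adjacency_matrix_def matrix_vector_mult_def z) (simp add: y_def)
    qed
    ultimately show "z \<in> ?L" by (auto simp: eigenvalues_def)
  qed
next
  show "?L \<subseteq> of_real ` ?R"
  proof
    fix z assume "z \<in> ?L"
    then obtain x where x: "x \<noteq> 0" "adjacency_matrix E *v x = z *s x" by (auto simp: eigenvalues_def)
    define u v :: "real ^ 'v" where "u = (\<chi> i. Re (x $ i))" and "v = (\<chi> i. Im (x $ i))"
    have ev: "(\<Sum>j\<in>UNIV. (if E i j then 1 else 0) * x $ j) = z * x $ i" for i
      using x(2) by (simp add: adjacency_matrix_def matrix_vector_mult_def vec_eq_iff)
    have "(\<Sum>j\<in>UNIV. adj E i j * u $ j) = Re z * u $ i - Im z * v $ i" for i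
      using arg_cong[OF ev[of i], of Re]
      by (simp add: u_def v_def adj_def if_distrib[of "\<lambda>t. t * _"] if_distrib[of Re] cong: if_cong)
    then have fu: "adj_map E u = Re z *\<^sub>R u - Im z *\<^sub>R v"
      by (simp add: adj_map_def vec_eq_iff)
    have "(\<Sum>j\<in>UNIV. adj E i j * v $ j) = Re z * v $ i + Im z * u $ i" for i
      using arg_cong[OF ev[of i], of Im]
      by (simp add: u_def v_def adj_def if_distrib[of "\<lambda>t. t * _"] if_distrib[of Im] cong: if_cong)
    then have fv: "adj_map E v = Re z *\<^sub>R v + Im z *\<^sub>R u"
      by (simp add: adj_map_def vec_eq_iff)
    have uv: "u \<noteq> 0 \<or> v \<noteq> 0" using x(1) by (auto simp: u_def v_def vec_eq_iff complex_eq_iff)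
    have "Im z * (u \<bullet> u + v \<bullet> v) = 0"
      using adj_map_sym[OF assms, of u v]
      by (simp add: fu fv inner_diff inner_add inner_commute algebra_simps)
    moreover have "u \<bullet> u + v \<bullet> v > 0"
      using uv by (metis add_nonneg_pos add_pos_nonneg inner_ge_zero inner_gt_zero_iff)
    ultimately have "Im z = 0" by simp
    then show "z \<in> of_real ` ?R" using uv fu fv
      by (intro image_eqI[of _ _ "Re z"]) (auto simp: complex_eq_iff)
  qed
qed

text \<open>
  A zero entry of a nonnegative eigenvector propagates along edges, hence through the whole
  connected graph.
\<close>

lemma adj_map_nonneg_vanish:
  assumes conn: "connected_graph E"
    and w: "\<And>i. 0 \<le> w $ i" "adj_map E w = m *\<^sub>R w" and zero: "w $ i = 0"
  shows "w = 0"
proof -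
  have step: "w $ k = 0" if "w $ j = 0" "E j k" for j k
  proof -
    have "(\<Sum>l\<in>UNIV. adj E j l * w $ l) = 0"
      using w(2) that(1) by (simp add: adj_map_def vec_eq_iff)
    then have "adj E j k * w $ k = 0"
      using w(1) by (subst (asm) sum_nonneg_eq_0_iff) (auto simp: adj_def)
    with that(2) show ?thesis by (simp add: adj_def)
  qed
  have "w $ j = 0" for j
  proof -
    have "E\<^sup>*\<^sup>* i j" using conn by (simp add: connected_graph_def)
    then show ?thesis by induction (auto intro: zero step)
  qed
  then show ?thesis by (simp add: vec_eq_iff)
qed

text \<open>
  The adjacency matrix is nonnegative, so replacing a maximiser of the Rayleigh quotient by its
  entrywise absolute value does not decrease the quotient.
\<close>

lemma adj_map_abs:
  assumes "simple_graph E"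
    and max: "\<And>x. x \<bullet> adj_map E x \<le> m * (x \<bullet> x)"
    and x: "adj_map E x = m *\<^sub>R x"
  shows "adj_map E (\<chi> i. \<bar>x $ i\<bar>) = m *\<^sub>R (\<chi> i. \<bar>x $ i\<bar>)"
proof -
  let ?y = "\<chi> i. \<bar>x $ i\<bar>"
  have "x \<bullet> adj_map E x \<le> ?y \<bullet> adj_map E ?y"
    unfolding inner_vec_def adj_map_def
    by (auto intro!: sum_mono simp: sum_distrib_left adj_def)
       (metis abs_ge_self abs_mult)
  moreover have "?y \<bullet> ?y = x \<bullet> x" by (simp add: inner_vec_def)
  ultimately have "?y \<bullet> adj_map E ?y = m * (?y \<bullet> ?y)"
    using max[of ?y] x by simp
  then show ?thesis
    using Rayleigh_max_imp_eigenvector[OF linear_adj_map adj_map_sym[OF assms(1)], of UNIV m ?y] max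
    by simp
qed

lemma Perron_Frobenius_graph:
  fixes E :: "'v::finite \<Rightarrow> 'v \<Rightarrow> bool"
  assumes simple: "simple_graph E" and conn: "connected_graph E"
  obtains m w where "\<And>i. 0 < w $ i" "adj_map E w = m *\<^sub>R w"
    "\<And>x. x \<bullet> adj_map E x \<le> m * (x \<bullet> x)"
    "\<And>x. adj_map E x = m *\<^sub>R x \<Longrightarrow> \<exists>t. x = t *\<^sub>R w"
proof -
  have "axis undefined 1 \<noteq> (0 :: real ^ 'v)" by simp
  then obtain m u where u: "u \<noteq> 0" "adj_map E u = m *\<^sub>R u"
    and max: "\<And>x. x \<bullet> adj_map E x \<le> m * (x \<bullet> x)"
    using self_adjoint_max_eigenvector[OF linear_adj_map adj_map_sym[OF simple] subspace_UNIV, of "axis undefined 1"]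
    by (metis UNIV_I)
  define w :: "real ^ 'v" where "w = (\<chi> i. \<bar>u $ i\<bar>)"
  have w: "adj_map E w = m *\<^sub>R w"
    unfolding w_def by (rule adj_map_abs[OF simple max u(2)])
  have "w \<noteq> 0" using u(1) by (auto simp: w_def vec_eq_iff)
  have pos: "0 < w $ i" for i
    using adj_map_nonneg_vanish[OF conn _ w, of i] \<open>w \<noteq> 0\<close>
    by (auto simp: w_def less_le)
  have "\<exists>t. x = t *\<^sub>R w" if x: "adj_map E x = m *\<^sub>R x" for x
  proof -
    define t where "t = x $ undefined / w $ undefined"
    \<comment> \<open>the multiple of \<open>w\<close> is chosen so that \<open>z\<close> has a zero entry\<close>
    define z where "z = x - t *\<^sub>R w"
    have "adj_map E z = m *\<^sub>R z"
      using x w by (simp add: z_def linear_diff[OF linear_adj_map] linear_scale[OF linear_adj_map]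
          algebra_simps)
    from adj_map_abs[OF simple max this] have "(\<chi> i. \<bar>z $ i\<bar>) = 0"
      using pos[of undefined] by (intro adj_map_nonneg_vanish[OF conn, of _ m undefined])
        (auto simp: z_def t_def)
    then have "z = 0" by (simp add: vec_eq_iff)
    then show ?thesis by (auto simp: z_def)
  qed
  with pos w max show thesis by (rule that)
qed

text \<open>
  The matrix equation behind the whole argument. If the spectrum is \<open>{m, \<theta>, \<tau>}\<close> with \<open>m\<close> the
  Perron eigenvalue, then \<open>(A - \<theta> I) (A - \<tau> I)\<close> is symmetric and maps everything into the
  one-dimensional \<open>m\<close>-eigenspace, so it has the form \<open>\<alpha> \<alpha>\<^sup>T\<close> for a positive multiple \<open>\<alpha>\<close> of the Perron
  vector. Here \<open>s = \<theta> + \<tau>\<close> and \<open>q = \<theta> \<tau>\<close>.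
\<close>

lemma three_eigenvalues_quadratic:
  fixes E :: "'v::finite \<Rightarrow> 'v \<Rightarrow> bool"
  assumes "E \<in> G3"
  obtains s q \<alpha> where "\<And>i. 0 < \<alpha> i"
    "\<And>i j. (\<Sum>k\<in>UNIV. adj E i k * adj E k j) = s * adj E i j - q * of_bool (i = j) + \<alpha> i * \<alpha> j"
proof -
  have simple: "simple_graph E" and conn: "connected_graph E"
    and card3: "card (eigenvalues (adjacency_matrix E)) = 3"
    using assms by (auto simp: G3_def)
  let ?f = "adj_map E"
  note lin = linear_adj_map[of E] and sym = adj_map_sym[OF simple]
  obtain w m where w: "\<And>i. 0 < w $ i" "?f w = m *\<^sub>R w"
    and max: "\<And>x. x \<bullet> ?f x \<le> m * (x \<bullet> x)"
    and unique: "\<And>x. ?f x = m *\<^sub>R x \<Longrightarrow> \<exists>t. x = t *\<^sub>R w"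
    by (rule Perron_Frobenius_graph[OF simple conn]) (rule that)
  define R where "R = {c. \<exists>x. x \<noteq> 0 \<and> ?f x = c *\<^sub>R x}"
  have "card R = 3"
  proof -
    have "card (complex_of_real ` R) = 3"
      using card3 by (simp add: eigenvalues_adjacency_matrix[OF simple] R_def)
    then show ?thesis by (subst (asm) card_image) (auto simp: inj_on_def)
  qed
  have "w \<noteq> 0" using w(1) by (metis less_irrefl zero_index)
  then have ww: "0 < w \<bullet> w" by simp
  have "m \<in> R" using w \<open>w \<noteq> 0\<close> by (auto simp: R_def)
  with \<open>card R = 3\<close> have "card (R - {m}) = 2" by (simp add: card_gt_0_iff)
  then obtain \<theta> \<tau> where Rm: "R - {m} = {\<theta>, \<tau>}" by (auto simp: card_2_iff)
  have below: "c < m" if "c \<in> R - {m}" for c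
  proof -
    from that obtain x where x: "x \<noteq> 0" "?f x = c *\<^sub>R x" by (auto simp: R_def)
    have "c * (x \<bullet> x) \<le> m * (x \<bullet> x)" using max[of x] x(2) by simp
    with x(1) that show ?thesis by (simp add: less_le)
  qed
  define K where "K = (m - \<theta>) * (m - \<tau>)"
  have "0 < K" using below Rm by (simp add: K_def)
  define g where "g x = ?f (?f x) - (\<theta> + \<tau>) *\<^sub>R ?f x + (\<theta> * \<tau>) *\<^sub>R x" for x
  have ling: "linear g"
    unfolding g_def
    by (rule linearI) (simp_all add: linear_add[OF lin] linear_scale[OF lin] algebra_simps)
  \<comment> \<open>every vector is a combination of eigenvectors, and \<open>g\<close> kills those for \<open>\<theta>\<close> and \<open>\<tau>\<close>\<close>
  have fg: "?f (g x) = m *\<^sub>R g x" for x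
  proof -
    have "x \<in> span {x. \<exists>c. ?f x = c *\<^sub>R x}"
      by (simp add: self_adjoint_eigenvectors_span[OF lin sym])
    then show ?thesis
    proof (induction rule: span_induct_alt)
      case base
      then show ?case by (simp add: linear_0[OF ling] linear_0[OF lin])
    next
      case (step a x y)
      then obtain c where c: "?f x = c *\<^sub>R x" by auto
      have gx: "g x = ((c - \<theta>) * (c - \<tau>)) *\<^sub>R x"
        by (simp add: g_def c linear_scale[OF lin] algebra_simps)
      have "x = 0 \<or> c \<in> R" using c by (auto simp: R_def)
      then have "x = 0 \<or> c = m \<or> c = \<theta> \<or> c = \<tau>" using Rm by auto
      then have "?f (g x) = m *\<^sub>R g x"
        by (auto simp: gx c linear_scale[OF lin] linear_0[OF lin] mult_ac)
      with step show ?case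
        by (simp add: linear_add[OF lin] linear_scale[OF lin] linear_add[OF ling]
            linear_scale[OF ling] algebra_simps)
    qed
  qed
  have gw: "g w = K *\<^sub>R w"
    by (simp add: g_def w linear_scale[OF lin] K_def algebra_simps)
  have gsym: "g x \<bullet> y = x \<bullet> g y" for x y
    by (simp add: g_def inner_add inner_diff sym)
  have gx: "g x = (K * (w \<bullet> x) / (w \<bullet> w)) *\<^sub>R w" for x
  proof -
    obtain t where t: "g x = t *\<^sub>R w" using unique[OF fg] by blast
    have "t * (w \<bullet> w) = K * (w \<bullet> x)"
      using gsym[of w x] by (simp add: t gw)
    then show ?thesis using t ww by (simp add: field_simps)
  qed
  have fax: "?f (axis j 1) $ i = adj E i j" for i j
    by (simp add: adj_map_def axis_def if_distrib[of "\<lambda>x. _ * x"] cong: if_cong)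
  have ffax: "?f (?f (axis j 1)) $ i = (\<Sum>k\<in>UNIV. adj E i k * adj E k j)" for i j
    by (subst adj_map_def) (simp add: fax)
  define r where "r = sqrt (K / (w \<bullet> w))"
  have r: "r * r = K / (w \<bullet> w)" "0 < r" using \<open>0 < K\<close> ww by (simp_all add: r_def)
  define \<alpha> where "\<alpha> i = r * w $ i" for i
  show thesis
  proof (rule that[of \<alpha> "\<theta> + \<tau>" "\<theta> * \<tau>"])
    show "0 < \<alpha> i" for i using r w by (simp add: \<alpha>_def)
    fix i j
    have "\<alpha> i * \<alpha> j = (r * r) * (w $ i * w $ j)" by (simp add: \<alpha>_def)
    also have "\<dots> = K / (w \<bullet> w) * (w $ i * w $ j)" by (simp only: r)
    also have "\<dots> = g (axis j 1) $ i"
      by (simp add: gx inner_axis)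
    also have "\<dots> = (\<Sum>k\<in>UNIV. adj E i k * adj E k j) - (\<theta> + \<tau>) * adj E i j + \<theta> * \<tau> * of_bool (i = j)"
      by (simp add: g_def ffax fax) (simp add: axis_def)
    finally show "(\<Sum>k\<in>UNIV. adj E i k * adj E k j)
        = (\<theta> + \<tau>) * adj E i j - \<theta> * \<tau> * of_bool (i = j) + \<alpha> i * \<alpha> j" by simp
  qed
qed

section \<open>The standard basis of a coherent algebra\<close>

text \<open>
  Two positions of a matrix have the same colour if no member of \<open>W\<close> distinguishes them. For a
  coherent algebra the colour classes are the basis relations of its coherent configuration.
\<close>

definition colour_class :: "(complex ^ 'v ^ 'v) set \<Rightarrow> 'v \<times> 'v \<Rightarrow> ('v \<times> 'v) set" where
  "colour_class W p = {q. \<forall>M\<in>W. M $ fst q $ snd q = M $ fst p $ snd p}"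

text \<open>
  The \<open>{0, 1}\<close>-matrix with support \<open>C\<close>.
\<close>

definition indicator_matrix :: "('v \<times> 'v) set \<Rightarrow> complex ^ 'v ^ 'v" where
  "indicator_matrix C = (\<chi> i j. if (i, j) \<in> C then 1 else 0)"

lemma colour_class_self [simp]: "p \<in> colour_class W p"
  by (simp add: colour_class_def)

lemma colour_class_eq_iff: "colour_class W p = colour_class W q \<longleftrightarrow> q \<in> colour_class W p"
proof
  assume "colour_class W p = colour_class W q"
  then show "q \<in> colour_class W p" by simp
next
  assume "q \<in> colour_class W p"
  then show "colour_class W p = colour_class W q" by (simp add: colour_class_def)
qed

lemma indicator_matrix_nth [simp]:
  "indicator_matrix C $ i $ j = (if (i, j) \<in> C then 1 else 0)"
  by (simp add: indicator_matrix_def)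

lemma inj_indicator_matrix: "inj indicator_matrix"
proof (rule injI)
  fix C D :: "('v::finite \<times> 'v) set"
  assume eq: "indicator_matrix C = indicator_matrix D"
  have "(i, j) \<in> C \<longleftrightarrow> (i, j) \<in> D" for i j
    using arg_cong[OF eq, of "\<lambda>M. M $ i $ j"] by (simp split: if_splits)
  then show "C = D" by auto
qed

text \<open>
  Interpolation: for each position \<open>q\<close> of another colour, some member of \<open>W\<close> is 1 at \<open>p\<close> and 0 at
  \<open>q\<close>; the entrywise product of these over all such \<open>q\<close> is the indicator matrix.
\<close>

lemma indicator_matrix_colour_class_in:
  assumes W: "coherent_algebra W"
  shows "indicator_matrix (colour_class W p) \<in> W"
proof -
  let ?at = "\<lambda>(M :: complex ^ 'a ^ 'a) q. M $ fst q $ snd q"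
  have sub: "cmat.subspace W" and J: "all_ones \<in> W"
    and had: "\<And>A B. A \<in> W \<Longrightarrow> B \<in> W \<Longrightarrow> entrywise_mult A B \<in> W"
    using W by (auto simp: coherent_algebra_def)
  have ex: "\<exists>F\<in>W. ?at F p = 1 \<and> (\<forall>q\<in>Q. ?at F q = 0)"
    if "finite Q" "Q \<subseteq> - colour_class W p" for Q
    using that
  proof (induction Q)
    case empty
    then show ?case using J by (intro bexI[of _ all_ones]) (auto simp: all_ones_def)
  next
    case (insert q Q)
    then obtain F where F: "F \<in> W" "?at F p = 1" "\<forall>q\<in>Q. ?at F q = 0" by auto
    from insert.prems obtain M where M: "M \<in> W" "?at M q \<noteq> ?at M p"
      by (auto simp: colour_class_def)
    define G where
      "G = cscale (1 / (?at M p - ?at M q)) (M - cscale (?at M q) all_ones)"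
    have "G \<in> W" unfolding G_def
      using M(1) J sub by (intro cmat.subspace_scale cmat.subspace_diff)
    moreover have "?at G p = 1" "?at G q = 0"
      using M(2) by (simp_all add: G_def cscale_def all_ones_def)
    ultimately show ?case
      using F had[of F G] by (intro bexI[of _ "entrywise_mult F G"]) (auto simp: entrywise_mult_def)
  qed
  then obtain F where F: "F \<in> W" "?at F p = 1" "\<And>q. q \<notin> colour_class W p \<Longrightarrow> ?at F q = 0"
    using ex[OF finite subset_refl] by (meson ComplI)
  have "?at F q = 1" if "q \<in> colour_class W p" for q
    using that F(1,2) by (simp add: colour_class_def)
  with F(3) have "F = indicator_matrix (colour_class W p)"
    by (auto simp: vec_eq_iff)
  with F(1) show ?thesis by simp
qed

text \<open>
  The supports of the members of a standard basis partition the positions.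
\<close>

lemma standard_basis_at:
  assumes B: "is_standard_basis W \<B>"
  obtains b where "b \<in> \<B>" "b $ i $ j = 1" "\<And>c. c \<in> \<B> \<Longrightarrow> c \<noteq> b \<Longrightarrow> c $ i $ j = 0"
proof -
  have fin: "finite \<B>" and val: "\<And>b. b \<in> \<B> \<Longrightarrow> b $ i $ j \<in> {0, 1}"
    and "\<Sum>\<B> = all_ones"
    using B by (auto simp: is_standard_basis_def)
  from arg_cong[OF this(3), of "\<lambda>M. M $ i $ j"]
  have "(\<Sum>b\<in>\<B>. b $ i $ j) = 1" by (simp add: all_ones_def)
  moreover have "(\<Sum>b\<in>\<B>. b $ i $ j) = (\<Sum>b\<in>{b\<in>\<B>. b $ i $ j = 1}. 1)"
    using fin val by (intro sum.mono_neutral_cong_right) auto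
  ultimately have "card {b\<in>\<B>. b $ i $ j = 1} = 1" by (simp flip: of_nat_eq_1_iff[where 'a = complex])
  then obtain b where b: "{b\<in>\<B>. b $ i $ j = 1} = {b}" by (auto simp: card_1_singleton_iff)
  show thesis
  proof (rule that[of b])
    show "b \<in> \<B>" "b $ i $ j = 1" using b by auto
    show "c $ i $ j = 0" if "c \<in> \<B>" "c \<noteq> b" for c using b val[of c] that by auto
  qed
qed

lemma standard_basis_eq_colour_classes:
  assumes B: "is_standard_basis W \<B>"
  shows "\<B> = indicator_matrix ` range (colour_class W)"
proof -
  have span: "cmat.span \<B> = W" and ind: "cmat.independent \<B>" and sub: "\<B> \<subseteq> W"
    and val: "\<And>b i j. b \<in> \<B> \<Longrightarrow> b $ i $ j \<in> {0, 1}"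
    using B by (auto simp: is_standard_basis_def)
  have const: "M $ fst p $ snd p = M $ fst q $ snd q"
    if "b \<in> \<B>" "b $ fst p $ snd p = 1" "b $ fst q $ snd q = 1" "M \<in> W" for b p q M
  proof -
    have eq: "c $ fst p $ snd p = c $ fst q $ snd q" if "c \<in> \<B>" for c
      using standard_basis_at[OF B, of "fst p" "snd p"] standard_basis_at[OF B, of "fst q" "snd q"]
        that \<open>b \<in> \<B>\<close> \<open>b $ fst p $ snd p = 1\<close> \<open>b $ fst q $ snd q = 1\<close> by (metis zero_neq_one)
    from \<open>M \<in> W\<close> have "M \<in> cmat.span \<B>" by (simp add: span)
    then show ?thesis
      by (induction rule: cmat.span_induct_alt) (auto simp: cscale_def eq)
  qed
  have cls: "b = indicator_matrix (colour_class W p)" if "b \<in> \<B>" "b $ fst p $ snd p = 1" for b p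
  proof -
    have "(b $ i $ j = 1) = ((i, j) \<in> colour_class W p)" for i j
      using const[OF that(1), of "(i, j)" p] that sub by (auto simp: colour_class_def)
    then show ?thesis using val[OF that(1)] by (auto simp: vec_eq_iff)
  qed
  show ?thesis
  proof (intro equalityI subsetI)
    fix b assume b: "b \<in> \<B>"
    with ind have "b \<noteq> 0" using cmat.dependent_zero by blast
    then obtain i j where "b $ i $ j \<noteq> 0" by (auto simp: vec_eq_iff)
    with val[OF b, of i j] cls[OF b, of "(i, j)"]
    show "b \<in> indicator_matrix ` range (colour_class W)" by auto
  next
    fix b assume "b \<in> indicator_matrix ` range (colour_class W)"
    then obtain p where p: "b = indicator_matrix (colour_class W p)" by auto
    obtain c where "c \<in> \<B>" "c $ fst p $ snd p = 1"
      using standard_basis_at[OF B] by metis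
    with cls p show "b \<in> \<B>" by auto
  qed
qed

lemma is_standard_basis_colour_classes:
  assumes W: "coherent_algebra W"
  shows "is_standard_basis W (indicator_matrix ` range (colour_class W))" (is "is_standard_basis W ?B")
proof -
  have sub: "cmat.subspace W" using W by (simp add: coherent_algebra_def)
  have BW: "?B \<subseteq> W" using indicator_matrix_colour_class_in[OF W] by auto
  have decomp: "(\<Sum>b\<in>?B. u b * b $ i $ j) = u (indicator_matrix (colour_class W (i, j)))" for u i j
  proof -
    have "(\<Sum>b\<in>?B. u b * b $ i $ j)
        = (\<Sum>C\<in>range (colour_class W). u (indicator_matrix C) * indicator_matrix C $ i $ j)"
      by (subst sum.reindex) (auto intro: inj_on_subset[OF inj_indicator_matrix])
    also have "\<dots> = (\<Sum>C\<in>{colour_class W (i, j)}. u (indicator_matrix C) * indicator_matrix C $ i $ j)"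
    proof (intro sum.mono_neutral_right ballI)
      fix C assume C: "C \<in> range (colour_class W) - {colour_class W (i, j)}"
      then obtain p where "C = colour_class W p" by auto
      with C have "(i, j) \<notin> C" by (auto simp: colour_class_eq_iff)
      then show "u (indicator_matrix C) * indicator_matrix C $ i $ j = 0" by simp
    qed auto
    finally show ?thesis by simp
  qed
  have "finite ?B" by simp
  have "cmat.independent ?B"
  proof (rule cmat.independent_if_scalars_zero[OF \<open>finite ?B\<close>])
    fix u b assume zero: "(\<Sum>b\<in>?B. cscale (u b) b) = 0" and "b \<in> ?B"
    then obtain i j where b: "b = indicator_matrix (colour_class W (i, j))" by auto
    from arg_cong[OF zero, of "\<lambda>M. M $ i $ j"] show "u b = 0"
      by (simp add: cscale_def decomp b)
  qed
  moreover have "W \<subseteq> cmat.span ?B"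
  proof
    fix M assume M: "M \<in> W"
    \<comment> \<open>the coefficient of a class is the common value of \<open>M\<close> on it\<close>
    define u where "u b = (let p = SOME p. b $ fst p $ snd p = 1 in M $ fst p $ snd p)"
      for b :: "complex ^ 'a ^ 'a"
    have u: "u (indicator_matrix (colour_class W (i, j))) = M $ i $ j" for i j
    proof -
      let ?p = "SOME p. indicator_matrix (colour_class W (i, j)) $ fst p $ snd p = 1"
      have "indicator_matrix (colour_class W (i, j)) $ fst ?p $ snd ?p = 1"
        by (rule someI[of _ "(i, j)"]) simp
      then have "?p \<in> colour_class W (i, j)" by (simp split: if_splits)
      with M show ?thesis by (simp add: u_def Let_def colour_class_def)
    qed
    have "M = (\<Sum>b\<in>?B. cscale (u b) b)"
      by (simp add: vec_eq_iff cscale_def decomp u)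
    also have "\<dots> \<in> cmat.span ?B"
      by (intro cmat.span_sum cmat.span_scale cmat.span_base)
    finally show "M \<in> cmat.span ?B" .
  qed
  moreover have "\<Sum>?B = all_ones"
    using decomp[of "\<lambda>_. 1"] by (simp add: vec_eq_iff all_ones_def)
  ultimately show ?thesis
    using cmat.span_minimal[OF BW sub] BW by (auto simp: is_standard_basis_def)
qed

lemma algebra_rank_eq_card_colour_classes:
  assumes "coherent_algebra W"
  shows "algebra_rank W = card (range (colour_class W))"
proof -
  have "standard_basis W = indicator_matrix ` range (colour_class W)"
    unfolding standard_basis_def
    using is_standard_basis_colour_classes[OF assms] standard_basis_eq_colour_classes
    by (intro the_equality) auto
  then show ?thesis
    by (simp add: algebra_rank_def card_image inj_on_subset[OF inj_indicator_matrix])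
qed

section \<open>Colourings by two parts, and joins\<close>

lemma card_range_mono:
  fixes g :: "'a::finite \<Rightarrow> 'b" and h :: "'a \<Rightarrow> 'c"
  assumes "\<And>p p'. g p = g p' \<Longrightarrow> h p = h p'"
  shows "card (range h) \<le> card (range g)"
proof -
  have "h p = h (inv g (g p))" for p
    by (rule assms) (simp add: f_inv_into_f)
  then have "range h \<subseteq> (\<lambda>c. h (inv g c)) ` range g" by blast
  then show ?thesis by (meson card_image_le card_mono finite finite_imageI order_trans)
qed

text \<open>
  The colouring of pairs of vertices generated by the equality relation, the adjacency relation and
  the bipartition of the vertices into \<open>X\<close> and its complement.
\<close>

definition block_colour :: "('v \<Rightarrow> 'v \<Rightarrow> bool) \<Rightarrow> 'v set \<Rightarrow> 'v \<times> 'v \<Rightarrow> bool \<times> bool \<times> bool \<times> bool" where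
  "block_colour E X = (\<lambda>(i, j). (i \<in> X, j \<in> X, i = j, E i j))"

text \<open>
  Connected graphs whose adjacency matrix satisfies \<open>A\<^sup>2 = s A - q I + \<alpha> \<alpha>\<^sup>T\<close> with a positive vector
  \<open>\<alpha>\<close>. The diagonal of this equation says that the degree of a vertex \<open>i\<close> is \<open>(\<alpha> i)\<^sup>2 - q\<close>, so \<open>\<alpha>\<close> is
  determined by the degrees.
\<close>

locale quadratic_graph =
  fixes E :: "'v::finite \<Rightarrow> 'v \<Rightarrow> bool" and s q :: real and \<alpha> :: "'v \<Rightarrow> real"
  assumes simple: "simple_graph E" and connected: "connected_graph E"
    and \<alpha>_pos: "0 < \<alpha> i"
    and quadratic: "(\<Sum>k\<in>UNIV. adj E i k * adj E k j) = s * adj E i j - q * of_bool (i = j) + \<alpha> i * \<alpha> j"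
begin

lemma adj_commute: "adj E i j = adj E j i"
  by (rule adj_sym[OF simple])

lemma E_commute: "E i j \<longleftrightarrow> E j i"
  using simple by (auto simp: simple_graph_def dest: sympD)

lemma not_E_self [simp]: "\<not> E i i"
  using simple by (auto simp: simple_graph_def irreflp_def)

lemma adj_self [simp]: "adj E i i = 0"
  by (simp add: adj_def)

lemma adj_idem [simp]: "adj E i j * adj E i j = adj E i j"
  by (simp add: adj_def)

lemma adj_nonneg [simp]: "0 \<le> adj E i j"
  by (simp add: adj_def)

lemma adj_le_1 [simp]: "adj E i j \<le> 1"
  by (simp add: adj_def)

lemma sum_split: "(\<Sum>k\<in>UNIV. f k) = (\<Sum>k\<in>X. f k) + (\<Sum>k\<in>-X. f k)" for f :: "'v \<Rightarrow> real"
  by (subst sum.union_disjoint[symmetric]) auto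

lemma degree_eq: "(\<Sum>k\<in>UNIV. adj E i k) = (\<alpha> i)\<^sup>2 - q"
  using quadratic[of i i] by (simp add: adj_commute[of _ i] power2_eq_square)

text \<open>
  Suppose that the graph is a join of its restrictions to \<open>X\<close> and to the complement, and \<open>\<alpha>\<close> is
  constant on both parts. Then every block of \<open>A\<^sup>2\<close> is a combination of \<open>I\<close>, \<open>J\<close> and the block of \<open>A\<close>,
  whence the matrices that are constant on the classes of \<open>block_colour\<close> form a coherent algebra.
  For \<open>X = UNIV\<close> this covers regular graphs.
\<close>

lemma join_coherent_algebra:
  assumes join: "\<And>i j. i \<in> X \<Longrightarrow> j \<notin> X \<Longrightarrow> E i j"
    and \<alpha>: "\<And>i. \<alpha> i = a (i \<in> X)"
  shows "coherent_algebra {M :: complex ^ 'v ^ 'v.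
    \<forall>i j i' j'. block_colour E X (i, j) = block_colour E X (i', j') \<longrightarrow> M $ i $ j = M $ i' $ j'}"
    (is "coherent_algebra ?A")
proof -
  define \<beta> where "\<beta> i = (i \<in> X)" for i
  define A where "A i j = (of_bool (E i j) :: complex)" for i j
  have A_adj: "A i j = of_real (adj E i j)" for i j by (simp add: A_def adj_def)
  have cross: "E i j" if "\<beta> i \<noteq> \<beta> j" for i j
    using join that E_commute by (auto simp: \<beta>_def)
  have deg: "(\<Sum>k\<in>UNIV. A i k) = of_real ((a (\<beta> i))\<^sup>2 - q)" for i
    unfolding A_adj of_real_sum[symmetric] degree_eq by (simp add: \<alpha> \<beta>_def)
  have quad: "(\<Sum>k\<in>UNIV. A i k * A k j)
      = of_real s * A i j - of_real q * of_bool (i = j) + of_real (a (\<beta> i) * a (\<beta> j))" for i j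
    unfolding A_adj of_real_mult[symmetric] of_real_sum[symmetric] quadratic
    by (simp add: \<alpha> \<beta>_def)
  \<comment> \<open>\<open>cnt b\<close> is the size of the part other than \<open>b\<close>, and \<open>D b\<close> the degree inside part \<open>b\<close>\<close>
  define cnt where "cnt b = (\<Sum>k\<in>UNIV. of_bool (\<beta> k \<noteq> b) :: complex)" for b
  define D where "D b = of_real ((a b)\<^sup>2 - q) - cnt b" for b
  have degD: "(\<Sum>k\<in>UNIV. of_bool (\<beta> k = \<beta> i) * A i k) = D (\<beta> i)" for i
  proof -
    have "(\<Sum>k\<in>UNIV. of_bool (\<beta> k = \<beta> i) * A i k) = (\<Sum>k\<in>UNIV. A i k - of_bool (\<beta> k \<noteq> \<beta> i))"
      by (intro sum.cong refl) (use cross in \<open>auto simp: A_def\<close>)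
    then show ?thesis by (simp add: sum_subtractf deg D_def cnt_def)
  qed
  have A_sym: "A i j = A j i" for i j by (simp add: A_def E_commute)
  have degD': "(\<Sum>k\<in>UNIV. of_bool (\<beta> k = \<beta> j) * A k j) = D (\<beta> j)" for j
    using degD[of j] by (simp add: A_sym)
  have quadD: "(\<Sum>k\<in>UNIV. of_bool (\<beta> k = \<beta> i) * (A i k * A k j))
      = of_real s * A i j - of_real q * of_bool (i = j) + of_real ((a (\<beta> i))\<^sup>2) - cnt (\<beta> i)"
    if "\<beta> i = \<beta> j" for i j
  proof -
    have "(\<Sum>k\<in>UNIV. of_bool (\<beta> k = \<beta> i) * (A i k * A k j))
        = (\<Sum>k\<in>UNIV. A i k * A k j - of_bool (\<beta> k \<noteq> \<beta> i))"
      by (intro sum.cong refl) (use cross that in \<open>auto simp: A_def\<close>)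
    then show ?thesis
      by (simp add: sum_subtractf quad cnt_def that power2_eq_square)
  qed
  \<comment> \<open>off-diagonal blocks need no \<open>A\<close>-coefficient, since all their entries are edges\<close>
  have form: "\<exists>x y z. \<forall>i j. M $ i $ j
      = x (\<beta> i) (\<beta> j) + y (\<beta> i) * of_bool (i = j) + z (\<beta> i) * (of_bool (\<beta> i = \<beta> j) * A i j)"
    if M: "M \<in> ?A" for M
  proof -
    define v where "v c = (case inv (block_colour E X) c of (i, j) \<Rightarrow> M $ i $ j)" for c
    have v: "M $ i $ j = v (\<beta> i, \<beta> j, i = j, E i j)" for i j
    proof -
      obtain i' j' where p: "inv (block_colour E X) (block_colour E X (i, j)) = (i', j')"
        by (metis surj_pair)
      have "block_colour E X (inv (block_colour E X) (block_colour E X (i, j))) = block_colour E X (i, j)"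
        by (rule f_inv_into_f) simp
      then have "block_colour E X (i, j) = block_colour E X (i', j')" unfolding p by simp
      then have "M $ i $ j = M $ i' $ j'" using M by blast
      also have "\<dots> = v (block_colour E X (i, j))" by (simp add: v_def p)
      finally show ?thesis by (simp add: block_colour_def \<beta>_def)
    qed
    let ?x = "\<lambda>b b'. if b = b' then v (b, b, False, False) else v (b, b', False, True)"
    let ?y = "\<lambda>b. v (b, b, True, False) - v (b, b, False, False)"
    let ?z = "\<lambda>b. v (b, b, False, True) - v (b, b, False, False)"
    have eq: "M $ i $ j = ?x (\<beta> i) (\<beta> j) + ?y (\<beta> i) * of_bool (i = j)
        + ?z (\<beta> i) * (of_bool (\<beta> i = \<beta> j) * A i j)" for i j
    proof (cases "\<beta> i = \<beta> j")
      case True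
      then show ?thesis by (cases "i = j"; cases "E i j") (simp_all add: v A_def)
    next
      case False
      then have "E i j" "i \<noteq> j" using cross by auto
      with False show ?thesis by (simp add: v)
    qed
    show ?thesis
      by (rule exI[of _ ?x], rule exI[of _ ?y], rule exI[of _ ?z]) (intro allI eq)
  qed
  have mult: "M ** M' \<in> ?A" if M: "M \<in> ?A" and M': "M' \<in> ?A" for M M' :: "complex ^ 'v ^ 'v"
  proof -
    obtain x y z where M_form: "\<forall>i j. M $ i $ j
      = x (\<beta> i) (\<beta> j) + y (\<beta> i) * of_bool (i = j) + z (\<beta> i) * (of_bool (\<beta> i = \<beta> j) * A i j)"
      using form[OF M] by (elim exE)
    obtain x' y' z' where M'_form: "\<forall>i j. M' $ i $ j
      = x' (\<beta> i) (\<beta> j) + y' (\<beta> i) * of_bool (i = j) + z' (\<beta> i) * (of_bool (\<beta> i = \<beta> j) * A i j)"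
      using form[OF M'] by (elim exE)
    \<comment> \<open>the entry of \<open>M ** M'\<close> at \<open>(i, j)\<close> as a function of the colour of \<open>(i, j)\<close>\<close>
    define F where "F b b' e r = (\<Sum>k\<in>UNIV. x b (\<beta> k) * x' (\<beta> k) b')
        + x b b' * y' b' + x b b' * z' b' * D b' + y b * x' b b' + y b * y' b * of_bool e
        + (y b * z' b + z b * y' b) * (of_bool (b = b') * of_bool r) + z b * x' b b' * D b
        + z b * z' b * of_bool (b = b')
          * (of_real s * of_bool r - of_real q * of_bool e + of_real ((a b)\<^sup>2) - cnt b)" for b b' e r
    have "(M ** M') $ i $ j = F (\<beta> i) (\<beta> j) (i = j) (E i j)" for i j
    proof -
      have "(M ** M') $ i $ j = (\<Sum>k\<in>UNIV. M $ i $ k * M' $ k $ j)"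
        by (simp add: matrix_matrix_mult_def)
      also have "\<dots> = (\<Sum>k\<in>UNIV.
            x (\<beta> i) (\<beta> k) * x' (\<beta> k) (\<beta> j)
          + x (\<beta> i) (\<beta> j) * y' (\<beta> j) * of_bool (k = j)
          + x (\<beta> i) (\<beta> j) * z' (\<beta> j) * (of_bool (\<beta> k = \<beta> j) * A k j)
          + y (\<beta> i) * x' (\<beta> i) (\<beta> j) * of_bool (k = i)
          + y (\<beta> i) * y' (\<beta> i) * of_bool (i = j) * of_bool (k = i)
          + y (\<beta> i) * z' (\<beta> i) * (of_bool (\<beta> i = \<beta> j) * A i j) * of_bool (k = i)
          + z (\<beta> i) * x' (\<beta> i) (\<beta> j) * (of_bool (\<beta> k = \<beta> i) * A i k)
          + z (\<beta> i) * y' (\<beta> i) * (of_bool (\<beta> i = \<beta> j) * A i j) * of_bool (k = j)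
          + z (\<beta> i) * z' (\<beta> i) * of_bool (\<beta> i = \<beta> j) * (of_bool (\<beta> k = \<beta> i) * (A i k * A k j)))"
        by (intro sum.cong refl) (simp add: M_form M'_form algebra_simps)
      also have "\<dots> = (\<Sum>k\<in>UNIV. x (\<beta> i) (\<beta> k) * x' (\<beta> k) (\<beta> j))
          + x (\<beta> i) (\<beta> j) * y' (\<beta> j)
          + x (\<beta> i) (\<beta> j) * z' (\<beta> j) * D (\<beta> j)
          + y (\<beta> i) * x' (\<beta> i) (\<beta> j)
          + y (\<beta> i) * y' (\<beta> i) * of_bool (i = j)
          + y (\<beta> i) * z' (\<beta> i) * (of_bool (\<beta> i = \<beta> j) * A i j)
          + z (\<beta> i) * x' (\<beta> i) (\<beta> j) * D (\<beta> i)
          + z (\<beta> i) * y' (\<beta> i) * (of_bool (\<beta> i = \<beta> j) * A i j)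
          + z (\<beta> i) * z' (\<beta> i) * of_bool (\<beta> i = \<beta> j)
            * (\<Sum>k\<in>UNIV. of_bool (\<beta> k = \<beta> i) * (A i k * A k j))"
        unfolding sum.distrib sum_distrib_left[symmetric] degD degD'
        by simp
      also have "\<dots> = F (\<beta> i) (\<beta> j) (i = j) (E i j)"
      proof (cases "\<beta> i = \<beta> j")
        case True
        then show ?thesis unfolding quadD[OF True] using True by (simp add: F_def algebra_simps flip: A_def)
      next
        case False
        then show ?thesis by (simp add: F_def algebra_simps)
      qed
      finally show ?thesis .
    qed
    then show ?thesis by (auto simp: block_colour_def \<beta>_def)
  qed
  have const: "M $ i $ j = M $ i' $ j'"
    if "M \<in> ?A" "block_colour E X (i, j) = block_colour E X (i', j')"
    for M :: "complex ^ 'v ^ 'v" and i j i' j'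
    using that by blast
  have "cmat.subspace ?A"
  proof (rule cmat.subspaceI)
    fix M M' assume M: "M \<in> ?A" "M' \<in> ?A"
    have *: "M $ i $ j + M' $ i $ j = M $ i' $ j' + M' $ i' $ j'"
      if "block_colour E X (i, j) = block_colour E X (i', j')" for i j i' j'
      using const[OF M(1) that] const[OF M(2) that] by simp
    show "M + M' \<in> ?A"
      unfolding mem_Collect_eq vector_add_component by (intro allI impI) (rule *)
  next
    fix c M assume M: "M \<in> ?A"
    have *: "c * M $ i $ j = c * M $ i' $ j'"
      if "block_colour E X (i, j) = block_colour E X (i', j')" for i j i' j'
      using const[OF M that] by simp
    show "cscale c M \<in> ?A"
      unfolding mem_Collect_eq cscale_def vec_lambda_beta by (intro allI impI) (rule *)
  qed (unfold mem_Collect_eq zero_index, intro allI impI refl)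
  moreover have "mat 1 \<in> ?A" by (simp add: mat_def block_colour_def)
  moreover have "all_ones \<in> ?A" by (simp add: all_ones_def)
  moreover have "\<forall>M\<in>?A. transpose M \<in> ?A"
  proof
    fix M assume M: "M \<in> ?A"
    have *: "M $ j $ i = M $ j' $ i'" if "block_colour E X (i, j) = block_colour E X (i', j')" for i j i' j'
      using that by (intro const[OF M]) (auto simp: block_colour_def E_commute)
    show "transpose M \<in> ?A"
      unfolding mem_Collect_eq transpose_def vec_lambda_beta by (intro allI impI) (rule *)
  qed
  moreover have "\<forall>M\<in>?A. \<forall>M'\<in>?A. entrywise_mult M M' \<in> ?A"
  proof (intro ballI)
    fix M M' assume M: "M \<in> ?A" "M' \<in> ?A"
    have *: "M $ i $ j * M' $ i $ j = M $ i' $ j' * M' $ i' $ j'"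
      if "block_colour E X (i, j) = block_colour E X (i', j')" for i j i' j'
      using const[OF M(1) that] const[OF M(2) that] by simp
    show "entrywise_mult M M' \<in> ?A"
      unfolding mem_Collect_eq entrywise_mult_def vec_lambda_beta by (intro allI impI) (rule *)
  qed
  moreover have "\<forall>M\<in>?A. \<forall>M'\<in>?A. M ** M' \<in> ?A" by (intro ballI mult)
  ultimately show ?thesis unfolding coherent_algebra_def by (intro conjI)
qed

lemma coherent_rank_join_le:
  assumes join: "\<And>i j. i \<in> X \<Longrightarrow> j \<notin> X \<Longrightarrow> E i j"
    and \<alpha>: "\<And>i j. i \<in> X \<longleftrightarrow> j \<in> X \<Longrightarrow> \<alpha> i = \<alpha> j"
  shows "coherent_rank E \<le> card (range (block_colour E X))"
proof -
  let ?A = "{M :: complex ^ 'v ^ 'v. \<forall>i j i' j'.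
    block_colour E X (i, j) = block_colour E X (i', j') \<longrightarrow> M $ i $ j = M $ i' $ j'}"
  have "\<alpha> i = \<alpha> (SOME j. (j \<in> X) = (i \<in> X))" for i
    by (rule \<alpha>) (metis (mono_tags, lifting) someI)
  then have "coherent_algebra ?A"
    by (intro join_coherent_algebra[OF join, where a = "\<lambda>b. \<alpha> (SOME j. (j \<in> X) = b)"])
  moreover have "adjacency_matrix E \<in> ?A"
    by (simp add: adjacency_matrix_def block_colour_def)
  ultimately have sub: "coherent_closure E \<subseteq> ?A" by (rule coherent_closure_least)
  have "card (range (colour_class (coherent_closure E))) \<le> card (range (block_colour E X))"
  proof (rule card_range_mono)
    fix p p' :: "'v \<times> 'v"
    assume eq: "block_colour E X p = block_colour E X p'"
    have "M $ fst p' $ snd p' = M $ fst p $ snd p" if "M \<in> coherent_closure E" for M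
    proof -
      have "M \<in> ?A" using that sub by (rule subsetD[rotated])
      then have "\<forall>i j i' j'. block_colour E X (i, j) = block_colour E X (i', j') \<longrightarrow> M $ i $ j = M $ i' $ j'"
        by (rule CollectD)
      from this[rule_format, of "fst p'" "snd p'" "fst p" "snd p"] show ?thesis using eq by simp
    qed
    then have "p' \<in> colour_class (coherent_closure E) p"
      by (simp add: colour_class_def)
    then show "colour_class (coherent_closure E) p = colour_class (coherent_closure E) p'"
      by (simp add: colour_class_eq_iff)
  qed
  then show ?thesis
    by (simp add: coherent_rank_def algebra_rank_eq_card_colour_classes
        coherent_algebra_coherent_closure)
qed

text \<open>
  In a join, the part \<open>X\<close> induces a regular graph of degree \<open>k\<close>; the second identity is the sum over
  \<open>j \<in> X\<close> of the \<open>(i, j)\<close>-entries of the quadratic equation.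
\<close>

lemma join_block_row_sums:
  assumes join: "\<And>i j. i \<in> X \<Longrightarrow> j \<notin> X \<Longrightarrow> E i j"
    and \<alpha>: "\<And>i. i \<in> X \<Longrightarrow> \<alpha> i = a" and i: "i \<in> X"
  defines "k \<equiv> a\<^sup>2 - q - real (card (-X))"
  shows "(\<Sum>j\<in>X. adj E i j) = k"
    and "k\<^sup>2 + real (card X) * real (card (-X)) = s * k - q + a\<^sup>2 * real (card X)"
    and "k + 1 \<le> real (card X)"
proof -
  have out: "adj E i j = 1" "adj E j i = 1" if "i \<in> X" "j \<in> -X" for i j
    using that join[of i j] by (auto simp: adj_def E_commute)
  have row: "(\<Sum>j\<in>X. adj E i j) = k" if "i \<in> X" for i
  proof -
    have "(\<Sum>j\<in>-X. adj E i j) = real (card (-X))"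
      using out[OF that] by simp
    then show ?thesis
      using degree_eq[of i] sum_split[of "adj E i" X] \<alpha>[OF that] by (simp add: k_def)
  qed
  show "(\<Sum>j\<in>X. adj E i j) = k" by (rule row[OF i])
  have "(\<Sum>j\<in>X. \<Sum>l\<in>UNIV. adj E i l * adj E l j) = (\<Sum>l\<in>UNIV. adj E i l * (\<Sum>j\<in>X. adj E l j))"
    by (subst sum.swap) (simp add: sum_distrib_left)
  also have "\<dots> = (\<Sum>l\<in>X. adj E i l * k) + (\<Sum>l\<in>-X. real (card X))"
    unfolding sum_split[of _ X] using row out i by (intro arg_cong2[of _ _ _ _ "(+)"] sum.cong refl) simp_all
  also have "\<dots> = k\<^sup>2 + real (card X) * real (card (-X))"
    using row[OF i] by (simp add: sum_distrib_right[symmetric] power2_eq_square)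
  finally have "(\<Sum>j\<in>X. \<Sum>l\<in>UNIV. adj E i l * adj E l j) = k\<^sup>2 + real (card X) * real (card (-X))" .
  moreover have "(\<Sum>j\<in>X. \<Sum>l\<in>UNIV. adj E i l * adj E l j)
      = (\<Sum>j\<in>X. s * adj E i j - q * of_bool (i = j) + a * a)"
    using \<alpha> i by (intro sum.cong refl) (simp add: quadratic)
  moreover have "\<dots> = s * k - q + a\<^sup>2 * real (card X)"
    using row[OF i] i
    by (simp add: sum.distrib sum_subtractf sum_distrib_left[symmetric] power2_eq_square of_bool_def
        cong: if_cong)
  ultimately show "k\<^sup>2 + real (card X) * real (card (-X)) = s * k - q + a\<^sup>2 * real (card X)" by simp
  have "k = (\<Sum>j\<in>X - {i}. adj E i j)"
    using row[OF i] i by (simp add: sum.remove[of X i])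
  also have "\<dots> \<le> (\<Sum>j\<in>X - {i}. 1)" by (intro sum_mono) simp
  also have "\<dots> = real (card X) - 1" using i card_gt_0_iff[of X] by (auto simp: of_nat_diff)
  finally show "k + 1 \<le> real (card X)" by simp
qed

text \<open>
  A join of two regular graphs, neither empty and one of them not complete, satisfies the quadratic
  equation only if it is regular. With \<open>n1, n2\<close> the sizes, \<open>k1, k2\<close> the inner degrees,
  \<open>l1, l2\<close> the degrees of the complements of the two parts, \<open>T = k1 + k2 + q + 1\<close> and
  \<open>e = a b - T\<close>, the equation gives \<open>a\<^sup>2 = T + l2\<close>, \<open>b\<^sup>2 = T + l1\<close> and \<open>e k\<^sub>i = l\<^sub>i (k\<^sub>i + q)\<close>. As \<open>q \<le> 0\<close>
  this yields \<open>e \<le> l1\<close> and \<open>e \<le> l2\<close>, while \<open>(T + l1) (T + l2) = (T + e)\<^sup>2\<close>; so \<open>l1 = e = l2\<close>.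
\<close>

lemma join_imp_same_weight:
  assumes join: "\<And>i j. i \<in> X \<Longrightarrow> j \<notin> X \<Longrightarrow> E i j"
    and a: "\<And>i. i \<in> X \<Longrightarrow> \<alpha> i = a" and b: "\<And>i. i \<notin> X \<Longrightarrow> \<alpha> i = b"
    and edge1: "i1 \<in> X" "j1 \<in> X" "E i1 j1"
    and edge2: "i2 \<notin> X" "j2 \<notin> X" "E i2 j2"
    and nonedge: "i3 \<in> X" "j3 \<in> X" "i3 \<noteq> j3" "\<not> E i3 j3"
  shows "a = b"
proof -
  define n1 n2 where "n1 = real (card X)" and "n2 = real (card (-X))"
  define k1 k2 where "k1 = a\<^sup>2 - q - n2" and "k2 = b\<^sup>2 - q - n1"
  have join': "E i j" if "i \<in> -X" "j \<notin> -X" for i j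
    using that join[of j i] by (simp add: E_commute)
  have b': "\<alpha> i = b" if "i \<in> -X" for i using b that by simp
  note block1 = join_block_row_sums[of X a i1, OF join a edge1(1)]
  note block2 = join_block_row_sums[of "-X" b i2, OF join' b', unfolded double_complement]
  have row1: "(\<Sum>j\<in>X. adj E i j) = k1" if "i \<in> X" for i
    using join_block_row_sums(1)[OF join a that] by (simp add: k1_def n2_def)
  have row2: "(\<Sum>j\<in>-X. adj E i j) = k2" if "i \<in> -X" for i
    using join_block_row_sums(1)[of "-X", OF join' b' that] by (simp add: k2_def n1_def)
  have k1: "0 < k1"
  proof -
    have "adj E i1 j1 \<le> (\<Sum>j\<in>X. adj E i1 j)" using edge1 by (intro member_le_sum) auto
    with edge1 row1 show ?thesis by (simp add: adj_def)
  qed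
  have k2: "0 < k2"
  proof -
    have "adj E i2 j2 \<le> (\<Sum>j\<in>-X. adj E i2 j)" using edge2 by (intro member_le_sum) auto
    with edge2 row2[of i2] show ?thesis by (simp add: adj_def)
  qed
  have cross: "k1 + k2 = s + a * b"
  proof -
    have "(\<Sum>k\<in>UNIV. adj E i1 k * adj E k i2)
        = (\<Sum>k\<in>X. adj E i1 k) + (\<Sum>k\<in>-X. adj E i2 k)"
      unfolding sum_split[of _ X]
      using join[of _ i2] join[OF edge1(1)] edge2
      by (intro arg_cong2[of _ _ _ _ "(+)"] sum.cong refl) (simp_all add: adj_def E_commute[of i2])
    then show ?thesis
      using quadratic[of i1 i2] edge1 edge2 row1 row2 a b join[of i1 i2] by (auto simp: adj_def)
  qed
  have common: "(\<Sum>k\<in>UNIV. adj E i3 k * adj E k j3) = a\<^sup>2"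
    using quadratic[of i3 j3] nonedge a by (simp add: adj_def power2_eq_square)
  \<comment> \<open>the common neighbours of a nonadjacent pair are at most as many as the degree\<close>
  have "q \<le> 0"
  proof -
    have "(\<Sum>k\<in>UNIV. adj E i3 k * adj E k j3) \<le> (\<Sum>k\<in>UNIV. adj E i3 k)"
      by (intro sum_mono) (simp add: mult_left_le)
    then show ?thesis using common degree_eq[of i3] a nonedge by simp
  qed
  \<comment> \<open>every vertex outside \<open>X\<close> is a common neighbour of \<open>i3\<close> and \<open>j3\<close>\<close>
  have "n2 \<le> a\<^sup>2"
  proof -
    have "(\<Sum>k\<in>-X. 1) \<le> (\<Sum>k\<in>-X. adj E i3 k * adj E k j3)"
      using join[OF nonedge(1)] join[OF nonedge(2)] by (intro sum_mono) (simp add: adj_def E_commute[of _ j3])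
    also have "\<dots> \<le> (\<Sum>k\<in>UNIV. adj E i3 k * adj E k j3)"
      by (intro sum_mono2) auto
    finally show ?thesis using common by (simp add: n2_def)
  qed
  have ab: "0 < a" "0 < b" using \<alpha>_pos[of i1] \<alpha>_pos[of i2] edge1 edge2 a b by auto
  define l1 l2 where "l1 = n1 - k1 - 1" and "l2 = n2 - k2 - 1"
  define T where "T = k1 + k2 + q + 1"
  define e where "e = a * b - T"
  have a2: "a\<^sup>2 = T + l2" and b2: "b\<^sup>2 = T + l1"
    by (simp_all add: T_def l1_def l2_def k1_def k2_def)
  have s: "s = - e - q - 1" using cross by (simp add: e_def T_def)
  have "k1\<^sup>2 + n1 * n2 = s * k1 - q + a\<^sup>2 * n1"
    using block1(2) by (simp add: k1_def n1_def n2_def)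
  moreover have "a\<^sup>2 = k1 + q + n2" "n1 = k1 + 1 + l1" by (simp_all add: k1_def l1_def)
  ultimately have e1: "e * k1 = l1 * (k1 + q)"
    unfolding s by (simp add: power2_eq_square) algebra
  have "k2\<^sup>2 + n2 * n1 = s * k2 - q + b\<^sup>2 * n2" using block2(2) edge2 by (simp add: k2_def n1_def n2_def)
  moreover have "b\<^sup>2 = k2 + q + n1" "n2 = k2 + 1 + l2" by (simp_all add: k2_def l2_def)
  ultimately have e2: "e * k2 = l2 * (k2 + q)"
    unfolding s by (simp add: power2_eq_square) algebra
  have l: "0 \<le> l1" "0 \<le> l2" using block1(3) block2(3) edge2
    by (simp_all add: l1_def l2_def k1_def k2_def n1_def n2_def)
  have "e * k1 \<le> l1 * k1" using e1 l \<open>q \<le> 0\<close> by (simp add: mult_left_mono)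
  then have "e \<le> l1" using k1 by simp
  have "e * k2 \<le> l2 * k2" using e2 l \<open>q \<le> 0\<close> by (simp add: mult_left_mono)
  then have "e \<le> l2" using k2 by simp
  have "0 < T + e" using ab by (simp add: e_def)
  have "(T + l1) * (T + l2) = (T + e) * (T + e)"
    unfolding a2[symmetric] b2[symmetric] by (simp add: e_def power2_eq_square)
  moreover have "(T + l1) * (T + l2) > (T + e) * (T + e)" if "e < l1"
    using that \<open>e \<le> l2\<close> \<open>0 < T + e\<close> by (intro mult_less_le_imp_less) auto
  moreover have "(T + l1) * (T + l2) > (T + e) * (T + e)" if "e < l2"
    using that \<open>e \<le> l1\<close> \<open>0 < T + e\<close> by (intro mult_le_less_imp_less) auto
  ultimately have "l1 = l2" using \<open>e \<le> l1\<close> \<open>e \<le> l2\<close> by (metis less_irrefl order_le_less)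
  then have "a\<^sup>2 = b\<^sup>2" using a2 b2 by simp
  with ab show ?thesis by (simp add: power2_eq_iff_nonneg)
qed

section \<open>Designs from cliques and independent sets\<close>

lemma adj_diff_sq: "(adj E i k - adj E j l)\<^sup>2 = adj E i k + adj E j l - 2 * (adj E i k * adj E j l)"
  by (simp add: adj_def)

text \<open>
  If the block of \<open>A\<close> on \<open>X\<close> is \<open>c (J - I)\<close> with \<open>c \<in> {0, 1}\<close> and \<open>N\<close> is the block of \<open>A\<close> with rows in \<open>X\<close>
  and columns outside \<open>X\<close>, then \<open>N N\<^sup>T\<close> is a combination of \<open>I\<close> and \<open>J\<close>.
\<close>

lemma uniform_block_Gram:
  assumes \<alpha>: "\<And>i. i \<in> X \<Longrightarrow> \<alpha> i = a"
    and c: "c * c = c" "\<And>i j. i \<in> X \<Longrightarrow> j \<in> X \<Longrightarrow> adj E i j = c * of_bool (i \<noteq> j)"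
    and ij: "i \<in> X" "j \<in> X"
  shows "(\<Sum>k\<in>-X. adj E i k * adj E j k)
    = (s * c + a\<^sup>2 - c * (real (card X) - 2)) + (- s * c - q - c) * of_bool (i = j)"
proof -
  have "(\<Sum>k\<in>X. adj E i k * adj E k j) = (\<Sum>k\<in>X. c * (1 - of_bool (k = i) - of_bool (k = j) + of_bool (k = i) * of_bool (i = j)))"
    using c ij by (intro sum.cong refl) auto
  also have "\<dots> = c * (real (card X) - 2 + of_bool (i = j))"
    using ij by (simp add: sum_distrib_left[symmetric] sum_distrib_right[symmetric] sum.distrib
        sum_subtractf of_bool_def cong: if_cong)
  finally have "(\<Sum>k\<in>X. adj E i k * adj E k j) = c * (real (card X) - 2 + of_bool (i = j))" .
  moreover have "(\<Sum>k\<in>-X. adj E i k * adj E j k) = (\<Sum>k\<in>-X. adj E i k * adj E k j)"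
    by (simp add: adj_commute[of j])
  ultimately show ?thesis
    using quadratic[of i j] sum_split[of "\<lambda>k. adj E i k * adj E k j" X] c(2)[OF ij] \<alpha> ij
    by (auto simp: power2_eq_square algebra_simps)
qed

text \<open>
  The desired structure in terms of vertex sets: \<open>X\<close> is independent, its complement is a clique, and
  the edges between them are the incidences of a symmetric 2-design with points \<open>X\<close>, whose blocks are
  the neighbourhoods in \<open>X\<close> of the vertices of the complement. The bound \<open>1 < l\<close> guarantees that
  different vertices of the complement have different neighbourhoods in \<open>X\<close>, because \<open>l \<noteq> l\<^sup>2\<close>.
\<close>

definition symmetric_design_split :: "'v set \<Rightarrow> nat \<Rightarrow> bool" where
  "symmetric_design_split X l \<longleftrightarrow>
    card X = l ^ 3 - l + 1 \<and> card (-X) = l ^ 3 - l + 1 \<and> 1 < l \<and>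
    (\<forall>i\<in>X. \<forall>j\<in>X. \<not> E i j) \<and> (\<forall>i\<in>-X. \<forall>j\<in>-X. E i j \<longleftrightarrow> i \<noteq> j) \<and>
    (\<forall>j\<in>-X. card {i\<in>X. E i j} = l\<^sup>2) \<and>
    (\<forall>i\<in>X. \<forall>j\<in>X. i \<noteq> j \<longrightarrow> card {k\<in>-X. E i k \<and> E j k} = l) \<and>
    (\<forall>i\<in>-X. \<forall>j\<in>-X. i \<noteq> j \<longrightarrow> card {k\<in>X. E k i \<and> E k j} = l)"

text \<open>
  The main computation. Write \<open>A\<close> in blocks as \<open>u (J - I)\<close>, \<open>N\<close>, \<open>N\<^sup>T\<close>, \<open>v (J - I)\<close>, where \<open>N\<close> is neither \<open>O\<close>
  nor \<open>J\<close> and has constant row sum \<open>r\<close> and constant column sum \<open>c\<close>. Both Gram matrices of \<open>N\<close> have the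
  form \<open>m I + \<mu> J\<close> with the same \<open>m \<noteq> 0\<close>; evaluating \<open>N N\<^sup>T N\<close> in two ways then gives \<open>r = c\<close> and so
  parts of equal size. Thus \<open>u = v\<close> would make the graph regular. For \<open>u = 0\<close>, \<open>v = 1\<close> the equations
  read \<open>r = a b\<close>, \<open>\<mu>1 = \<mu>2 = a\<^sup>2 = l\<close> and \<open>b\<^sup>2 = l + n - 1\<close>, where \<open>n\<close> is the common size of the parts;
  together with \<open>r\<^sup>2 = n l + r - l\<close> they yield \<open>r = l\<^sup>2\<close> and \<open>n = l\<^sup>3 - l + 1\<close>.
  The remaining alternative is the same with the two parts exchanged.
\<close>

lemma uniform_blocks_imp_design:
  assumes a: "\<And>i. i \<in> X \<Longrightarrow> \<alpha> i = a" and b: "\<And>i. i \<notin> X \<Longrightarrow> \<alpha> i = b" and ab: "a \<noteq> b"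
    and r: "\<And>i. i \<in> X \<Longrightarrow> (\<Sum>k\<in>-X. adj E i k) = r"
    and c: "\<And>j. j \<notin> X \<Longrightarrow> (\<Sum>k\<in>X. adj E k j) = c"
    and u: "u \<in> {0, 1}" "\<And>i j. i \<in> X \<Longrightarrow> j \<in> X \<Longrightarrow> adj E i j = u * of_bool (i \<noteq> j)"
    and v: "v \<in> {0, 1}" "\<And>i j. i \<notin> X \<Longrightarrow> j \<notin> X \<Longrightarrow> adj E i j = v * of_bool (i \<noteq> j)"
    and edge: "i0 \<in> X" "j0 \<notin> X" "E i0 j0"
    and nonedge: "i1 \<in> X" "j1 \<notin> X" "\<not> E i1 j1"
  shows "u = 0 \<and> v = 1 \<and> (\<exists>l. symmetric_design_split X l) \<or>
         u = 1 \<and> v = 0"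
proof -
  define n1 n2 where "n1 = real (card X)" and "n2 = real (card (-X))"
  define m where "m = u * v - q"
  define \<mu>1 where "\<mu>1 = s * u + a\<^sup>2 - u * (n1 - 2)"
  define \<mu>2 where "\<mu>2 = s * v + b\<^sup>2 - v * (n2 - 2)"
  have uu: "u * u = u" and vv: "v * v = v" using u v by auto
  have b': "\<alpha> i = b" if "i \<in> -X" for i using b that by simp
  have v': "adj E i j = v * of_bool (i \<noteq> j)" if "i \<in> -X" "j \<in> -X" for i j using v that by simp
  have cross: "u * (c - adj E i j) + v * (r - adj E i j) = s * adj E i j + a * b"
    if "i \<in> X" "j \<in> -X" for i j
  proof -
    have "(\<Sum>k\<in>X. adj E i k * adj E k j) = (\<Sum>k\<in>X. u * (adj E k j - adj E i j * of_bool (k = i)))"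
      using u that by (intro sum.cong refl) (auto simp: algebra_simps)
    moreover have "\<dots> = u * (c - adj E i j)"
      using that c[of j] by (simp add: sum_distrib_left[symmetric] sum_subtractf of_bool_def cong: if_cong)
    moreover have "(\<Sum>k\<in>-X. adj E i k * adj E k j) = (\<Sum>k\<in>-X. v * (adj E i k - adj E i j * of_bool (k = j)))"
      using v' that by (intro sum.cong refl) (auto simp: algebra_simps)
    moreover have "\<dots> = v * (r - adj E i j)"
      using that r[of i] by (simp add: sum_distrib_left[symmetric] sum_subtractf of_bool_def cong: if_cong)
    ultimately show ?thesis
      using quadratic[of i j] sum_split[of "\<lambda>k. adj E i k * adj E k j" X] that a b by auto
  qed
  \<comment> \<open>comparing a nonedge with an edge between the parts separates the two coefficients\<close>
  have uv: "u * c + v * r = a * b" using cross[of i1 j1] nonedge by (simp add: adj_def)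
  with cross[of i0 j0] edge have s: "s = - u - v" by (simp add: adj_def algebra_simps)
  have "- s * u - q - u = m" "- s * v - q - v = m"
    using uu vv by (simp_all add: s m_def algebra_simps)
  then have gram1: "(\<Sum>k\<in>-X. adj E i k * adj E j k) = \<mu>1 + m * of_bool (i = j)"
    if "i \<in> X" "j \<in> X" for i j
    using uniform_block_Gram[OF a uu u(2) that] by (simp add: \<mu>1_def n1_def)
  have gram2: "(\<Sum>k\<in>X. adj E k i * adj E k j) = \<mu>2 + m * of_bool (i = j)"
    if "i \<in> -X" "j \<in> -X" for i j
    using uniform_block_Gram[of "-X", OF b' vv v' that] \<open>- s * v - q - v = m\<close>
    by (simp add: \<mu>2_def n2_def adj_commute[of _ i] adj_commute[of _ j])
  have r_eq: "r = \<mu>1 + m" using gram1[of i0 i0] r[of i0] edge by simp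
  have c_eq: "c = \<mu>2 + m" using gram2[of j0 j0] c[of j0] edge by simp
  \<comment> \<open>otherwise all rows of \<open>N\<close> agree, and all columns, so that \<open>N\<close> is constant\<close>
  have "m \<noteq> 0"
  proof
    assume "m = 0"
    have row: "adj E i k = adj E j k" if "i \<in> X" "j \<in> X" "k \<in> -X" for i j k
    proof -
      have "(\<Sum>k\<in>-X. (adj E i k - adj E j k)\<^sup>2) = 0"
        using gram1[of i i] gram1[of i j] gram1[of j j] that \<open>m = 0\<close>
        by (simp add: adj_diff_sq sum.distrib sum_subtractf sum_distrib_left[symmetric])
      then show ?thesis using that by (simp add: sum_nonneg_eq_0_iff)
    qed
    have col: "adj E k i = adj E k j" if "i \<in> -X" "j \<in> -X" "k \<in> X" for i j k
    proof -
      have "(\<Sum>k\<in>X. (adj E k i - adj E k j)\<^sup>2) = 0"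
        using gram2[of i i] gram2[of i j] gram2[of j j] that \<open>m = 0\<close>
        by (simp add: adj_diff_sq sum.distrib sum_subtractf sum_distrib_left[symmetric])
      then show ?thesis using that by (simp add: sum_nonneg_eq_0_iff)
    qed
    have "adj E i0 j0 = adj E i1 j1" using row[of i0 i1 j0] col[of j0 j1 i1] edge nonedge by simp
    with edge nonedge show False by (simp add: adj_def)
  qed
  \<comment> \<open>the \<open>(i0, j0)\<close>-entry of \<open>N N\<^sup>T N\<close>\<close>
  have "\<mu>1 * c = \<mu>2 * r"
  proof -
    have "(\<Sum>k\<in>-X. \<Sum>l\<in>X. adj E i0 k * adj E l k * adj E l j0)
        = (\<Sum>k\<in>-X. adj E i0 k * (\<mu>2 + m * of_bool (k = j0)))"
      using edge by (intro sum.cong refl) (simp add: sum_distrib_left[symmetric] mult.assoc gram2)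
    also have "\<dots> = \<mu>2 * r + m * adj E i0 j0"
      using edge r[of i0] by (simp add: algebra_simps sum.distrib sum_distrib_left[symmetric] of_bool_def
          if_distrib[of "\<lambda>x. _ * x"] cong: if_cong)
    finally have 1: "(\<Sum>k\<in>-X. \<Sum>l\<in>X. adj E i0 k * adj E l k * adj E l j0) = \<mu>2 * r + m * adj E i0 j0" .
    have "(\<Sum>k\<in>-X. \<Sum>l\<in>X. adj E i0 k * adj E l k * adj E l j0)
        = (\<Sum>l\<in>X. (\<mu>1 + m * of_bool (l = i0)) * adj E l j0)"
      using edge by (subst sum.swap, intro sum.cong refl)
        (simp add: sum_distrib_right[symmetric] gram1 eq_commute)
    also have "\<dots> = \<mu>1 * c + m * adj E i0 j0"
      using edge c[of j0] by (simp add: algebra_simps sum.distrib sum_distrib_left[symmetric] of_bool_def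
          if_distrib[of "\<lambda>x. _ * x"] cong: if_cong)
    finally show ?thesis using 1 by simp
  qed
  then have "m * (r - c) = 0" by (simp add: r_eq c_eq algebra_simps)
  then have rc: "r = c" using \<open>m \<noteq> 0\<close> by simp
  have "adj E i0 j0 \<le> r" using edge by (subst r[of i0, symmetric]) (auto intro!: member_le_sum)
  then have "0 < r" using edge by (simp add: adj_def)
  have "n1 * r = (\<Sum>i\<in>X. \<Sum>k\<in>-X. adj E i k)" by (simp add: r n1_def)
  also have "\<dots> = (\<Sum>k\<in>-X. \<Sum>i\<in>X. adj E i k)" by (rule sum.swap)
  also have "\<dots> = n2 * r" by (simp add: c n2_def rc)
  finally have n: "n2 = n1" using \<open>0 < r\<close> by simp
  have pos: "0 < a" "0 < b" using \<alpha>_pos[of i0] \<alpha>_pos[of j0] edge a b by auto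
  have deg1: "u * (n1 - 1) + r = a\<^sup>2 - q"
  proof -
    have "(\<Sum>k\<in>X. adj E i0 k) = (\<Sum>k\<in>X. u * (1 - of_bool (k = i0)))"
      using u edge by (intro sum.cong refl) auto
    also have "\<dots> = u * (n1 - 1)"
      using edge by (simp add: sum_distrib_left[symmetric] sum_subtractf n1_def of_bool_def cong: if_cong)
    finally show ?thesis using degree_eq[of i0] sum_split[of "adj E i0" X] r[of i0] a edge by simp
  qed
  have deg2: "v * (n1 - 1) + r = b\<^sup>2 - q"
  proof -
    have "(\<Sum>k\<in>-X. adj E j0 k) = (\<Sum>k\<in>-X. v * (1 - of_bool (k = j0)))"
      using v' edge by (intro sum.cong refl) auto
    also have "\<dots> = v * (n2 - 1)"
      using edge by (simp add: sum_distrib_left[symmetric] sum_subtractf n2_def of_bool_def cong: if_cong)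
    finally show ?thesis using degree_eq[of j0] sum_split[of "adj E j0" X] c[of j0] b edge
      by (simp add: rc n adj_commute[of j0])
  qed
  have "u \<noteq> v"
  proof
    assume "u = v"
    with deg1 deg2 have "a\<^sup>2 = b\<^sup>2" by simp
    with pos ab show False by (simp add: power2_eq_iff_nonneg)
  qed
  then consider "u = 0" "v = 1" | "u = 1" "v = 0" using u v by auto
  then show ?thesis
  proof cases
    case 2
    then show ?thesis by simp
  next
    case 1
    define L where "L = a\<^sup>2"
    have "0 < L" using pos by (simp add: L_def)
    have l1: "\<mu>1 = L" by (simp add: \<mu>1_def L_def 1)
    have l2: "\<mu>2 = L" using r_eq c_eq rc l1 by simp
    then have b2: "b\<^sup>2 = L + n1 - 1" by (simp add: \<mu>2_def s 1 n)
    have r_ab: "r = a * b" using uv by (simp add: 1)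
    have "r * r = a\<^sup>2 * b\<^sup>2" by (simp add: r_ab power2_eq_square)
    then have rr: "r * r = L * (L + n1 - 1)" by (simp only: b2 flip: L_def)
    have m: "m = r - L" using r_eq l1 by simp
    have "r * r = n1 * L + m"
    proof -
      have "(\<Sum>j\<in>X. \<Sum>k\<in>-X. adj E i0 k * adj E j k) = (\<Sum>k\<in>-X. adj E i0 k * (\<Sum>j\<in>X. adj E j k))"
        by (subst sum.swap) (simp add: sum_distrib_left)
      also have "\<dots> = (\<Sum>k\<in>-X. adj E i0 k * r)"
        using c by (intro sum.cong refl) (simp add: rc)
      also have "\<dots> = r * r" using r[of i0] edge by (simp add: sum_distrib_right[symmetric])
      finally have "r * r = (\<Sum>j\<in>X. L + m * of_bool (i0 = j))"
        using gram1[of i0] edge l1 by simp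
      also have "\<dots> = n1 * L + m"
        using edge by (simp add: sum.distrib sum_distrib_left[symmetric] of_bool_def n1_def cong: if_cong)
      finally show ?thesis .
    qed
    with rr m have r_L: "r = L * L" by (simp add: algebra_simps)
    have "L * (L * L * L - L - (n1 - 1)) = 0"
      using rr unfolding r_L by (simp add: algebra_simps)
    then have n_L: "n1 = L ^ 3 - L + 1" using \<open>0 < L\<close> by (simp add: power3_eq_cube)
    have card1: "real (card {k\<in>-X. E i k \<and> E j k}) = L + m * of_bool (i = j)"
      if "i \<in> X" "j \<in> X" for i j
    proof -
      have "(\<Sum>k\<in>-X. adj E i k * adj E j k) = (\<Sum>k\<in>-X. if E i k \<and> E j k then 1 else 0)"
        by (intro sum.cong refl) (simp add: adj_def)
      also have "\<dots> = real (card {k\<in>-X. E i k \<and> E j k})"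
        by (simp add: sum.If_cases Int_def)
      finally show ?thesis using gram1[OF that] l1 by simp
    qed
    have card2: "real (card {k\<in>X. E k i \<and> E k j}) = L + m * of_bool (i = j)"
      if "i \<in> -X" "j \<in> -X" for i j
    proof -
      have "(\<Sum>k\<in>X. adj E k i * adj E k j) = (\<Sum>k\<in>X. if E k i \<and> E k j then 1 else 0)"
        by (intro sum.cong refl) (simp add: adj_def)
      also have "\<dots> = real (card {k\<in>X. E k i \<and> E k j})"
        by (simp add: sum.If_cases Int_def)
      finally show ?thesis using gram2[OF that] l2 by simp
    qed
    have "i0 \<noteq> i1 \<or> j0 \<noteq> j1" using edge nonedge by auto
    \<comment> \<open>\<open>L\<close> is the number of common neighbours, in the other part, of two vertices of one part\<close>
    then obtain l where l: "L = real l"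
      using card1[of i0 i1] card2[of j0 j1] edge nonedge by fastforce
    have "l \<noteq> 1" using \<open>m \<noteq> 0\<close> by (auto simp: m r_L l)
    then have "1 < l" using \<open>0 < L\<close> l by (cases "l = 0") auto
    have le: "l \<le> l ^ 3" by (simp add: power3_eq_cube)
    have "real (card X) = real (l ^ 3 - l + 1)" "real (card (-X)) = real (l ^ 3 - l + 1)"
      using n_L n le by (simp_all add: n1_def n2_def l of_nat_diff)
    then have "card X = l ^ 3 - l + 1" "card (-X) = l ^ 3 - l + 1"
      by (simp_all only: of_nat_eq_iff)
    moreover have "\<not> E i j" if "i \<in> X" "j \<in> X" for i j
      using u(2)[OF that] 1 by (simp add: adj_def split: if_splits)
    moreover have "E i j \<longleftrightarrow> i \<noteq> j" if "i \<in> -X" "j \<in> -X" for i j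
      using v'[OF that] 1 by (simp add: adj_def split: if_splits)
    moreover have "card {i\<in>X. E i j} = l\<^sup>2" if "j \<in> -X" for j
    proof -
      have "real (card {i\<in>X. E i j}) = real (l\<^sup>2)"
        using card2[OF that that] by (simp add: m r_L l power2_eq_square)
      then show ?thesis by (simp only: of_nat_eq_iff)
    qed
    moreover have "card {k\<in>-X. E i k \<and> E j k} = l" if "i \<in> X" "j \<in> X" "i \<noteq> j" for i j
      using card1[OF that(1,2)] that l by simp
    moreover have "card {k\<in>X. E k i \<and> E k j} = l" if "i \<in> -X" "j \<in> -X" "i \<noteq> j" for i j
      using card2[OF that(1,2)] that l by simp
    ultimately have "symmetric_design_split X l"
      using \<open>1 < l\<close> unfolding symmetric_design_split_def by blast
    with 1 show ?thesis by blast
  qed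
qed

end

section \<open>Fibres\<close>

lemma card_range_pair: "card (range (\<lambda>(i, j). (f i, f j))) = card (range f) * card (range f)"
proof -
  have "range (\<lambda>(i, j). (f i, f j)) = range f \<times> range f" by auto
  then show ?thesis by (simp add: card_cartesian_product)
qed

text \<open>
  The set \<open>X\<close> is a fibre (a class of vertices whose diagonal positions have the same colour). With
  \<open>t\<close> fibres there are at least \<open>t\<^sup>2\<close> colours, so rank 8 allows at most two fibres, and all vertices
  outside \<open>X\<close> form one class as well. If \<open>D\<close> is the diagonal indicator matrix of \<open>X\<close>, then \<open>A J\<close> and
  \<open>A D J\<close> lie in the coherent closure, so that the number of neighbours of a vertex, in all and in
  \<open>X\<close>, depends on its fibre only; and \<open>D J\<close>, \<open>J D\<close>, \<open>I\<close>, \<open>A\<close> together determine \<open>block_colour\<close>.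
\<close>

lemma coherent_rank_8_fibres:
  fixes E :: "'v::finite \<Rightarrow> 'v \<Rightarrow> bool"
  assumes "coherent_rank E = 8"
  obtains X where "X \<noteq> {}" "card (range (block_colour E X)) \<le> 8"
    "\<And>i j. i \<in> X \<longleftrightarrow> j \<in> X \<Longrightarrow> (\<Sum>k\<in>UNIV. adj E i k) = (\<Sum>k\<in>UNIV. adj E j k)"
    "\<And>i j. i \<in> X \<longleftrightarrow> j \<in> X \<Longrightarrow> (\<Sum>k\<in>X. adj E i k) = (\<Sum>k\<in>X. adj E j k)"
proof -
  define W where "W = coherent_closure E"
  have W: "coherent_algebra W" and AW: "adjacency_matrix E \<in> W"
    by (simp_all add: W_def coherent_algebra_coherent_closure)
  have I: "mat 1 \<in> W" and J: "all_ones \<in> W"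
    and mult: "\<And>M N. M \<in> W \<Longrightarrow> N \<in> W \<Longrightarrow> M ** N \<in> W"
    using W by (auto simp: coherent_algebra_def)
  have rank: "card (range (colour_class W)) = 8"
    using assms by (simp add: coherent_rank_def W_def algebra_rank_eq_card_colour_classes
        coherent_algebra_coherent_closure)
  have agree: "M $ i $ j = M $ i' $ j'"
    if "colour_class W (i, j) = colour_class W (i', j')" "M \<in> W" for M i j i' j'
  proof -
    have "(i, j) \<in> colour_class W (i', j')" unfolding that(1)[symmetric] by simp
    then show ?thesis using that(2) by (simp add: colour_class_def)
  qed
  define fib where "fib i = colour_class W (i, i)" for i
  \<comment> \<open>\<open>D v\<close> is the diagonal indicator matrix of the fibre of \<open>v\<close>\<close>
  define D :: "'v \<Rightarrow> complex ^ 'v ^ 'v"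
    where "D v = indicator_matrix (fib v)" for v
  have DW: "D v \<in> W" for v
    unfolding D_def fib_def by (rule indicator_matrix_colour_class_in[OF W])
  have D: "D v $ i $ j = of_bool (i = j \<and> fib i = fib v)" for v i j
  proof -
    have "i = j" if "(i, j) \<in> fib v"
      using agree[of v v i j "mat 1"] that I
      by (auto simp: fib_def mat_def colour_class_eq_iff split: if_splits)
    moreover have "(i, i) \<in> fib v \<longleftrightarrow> fib i = fib v"
      unfolding fib_def by (metis colour_class_eq_iff)
    ultimately show ?thesis by (auto simp: D_def)
  qed
  have DJ: "(D v ** all_ones) $ i $ j = of_bool (fib i = fib v)" for v i j
    by (cases "fib i = fib v") (simp_all add: matrix_matrix_mult_def D all_ones_def of_bool_def cong: if_cong)
  have JD: "(all_ones ** D v) $ i $ j = of_bool (fib j = fib v)" for v i j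
  proof -
    have "(all_ones ** D v) $ i $ j = (\<Sum>k\<in>UNIV. of_bool (k = j \<and> fib j = fib v))"
      unfolding matrix_matrix_mult_def vec_lambda_beta
      by (intro sum.cong refl) (auto simp: D all_ones_def)
    then show ?thesis by (cases "fib j = fib v") (simp_all add: of_bool_def cong: if_cong)
  qed
  have row: "fib i = fib i'" and col: "fib j = fib j'"
    if eq: "colour_class W (i, j) = colour_class W (i', j')" for i j i' j'
  proof -
    have "(D i ** all_ones) $ i $ j = (D i ** all_ones) $ i' $ j'"
      by (rule agree[OF eq mult[OF DW J]])
    then show "fib i = fib i'"
      by (simp add: DJ split: if_splits)
    have "(all_ones ** D j) $ i $ j = (all_ones ** D j) $ i' $ j'"
      by (rule agree[OF eq mult[OF J DW]])
    then show "fib j = fib j'"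
      by (simp add: JD split: if_splits)
  qed
  have "card (range (\<lambda>(i, j). (fib i, fib j))) \<le> card (range (colour_class W))"
  proof (rule card_range_mono)
    show "(case p of (i, j) \<Rightarrow> (fib i, fib j)) = (case p' of (i, j) \<Rightarrow> (fib i, fib j))"
      if eq: "colour_class W p = colour_class W p'" for p p'
    proof -
      obtain i j i' j' where p: "p = (i, j)" "p' = (i', j')" by (metis surj_pair)
      show ?thesis using row[OF eq[unfolded p]] col[OF eq[unfolded p]] by (simp add: p)
    qed
  qed
  then have "card (range fib) * card (range fib) \<le> 8" by (simp add: card_range_pair rank)
  then have fib2: "card (range fib) \<le> 2"
  proof (rule contrapos_pp)
    assume "\<not> card (range fib) \<le> 2"
    then have "3 * 3 \<le> card (range fib) * card (range fib)" by (intro mult_le_mono) simp_all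
    then show "\<not> card (range fib) * card (range fib) \<le> 8" by simp
  qed
  define v0 :: 'v where "v0 = undefined"
  define X where "X = {i. fib i = fib v0}"
  have X_fib: "fib i = fib j" if "i \<in> X \<longleftrightarrow> j \<in> X" for i j
  proof (cases "i \<in> X")
    case True
    with that show ?thesis by (simp add: X_def)
  next
    case False
    with that have ne: "fib i \<noteq> fib v0" "fib j \<noteq> fib v0" by (auto simp: X_def)
    show ?thesis
    proof (rule ccontr)
      assume "fib i \<noteq> fib j"
      with ne have "card {fib v0, fib i, fib j} = 3" by auto
      moreover have "card {fib v0, fib i, fib j} \<le> card (range fib)"
        by (intro card_mono) auto
      ultimately show False using fib2 by simp
    qed
  qed
  have A: "adjacency_matrix E $ i $ j = of_real (adj E i j)" for i j
    by (simp add: adjacency_matrix_def adj_def)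
  show thesis
  proof (rule that[of X])
    have "v0 \<in> X" by (simp add: X_def)
    then show "X \<noteq> {}" by blast
    have "card (range (block_colour E X)) \<le> card (range (colour_class W))"
    proof (rule card_range_mono)
      fix p p' assume eq: "colour_class W p = colour_class W p'"
      obtain i j i' j' where p: "p = (i, j)" "p' = (i', j')" by (metis surj_pair)
      note eq = eq[unfolded p]
      have "(i = j) = (i' = j')" using agree[OF eq I] by (simp add: mat_def split: if_splits)
      moreover have "E i j = E i' j'"
        using agree[OF eq AW] by (simp add: adjacency_matrix_def split: if_splits)
      ultimately show "block_colour E X p = block_colour E X p'"
        using row[OF eq] col[OF eq] by (simp add: p block_colour_def X_def)
    qed
    then show "card (range (block_colour E X)) \<le> 8" by (simp add: rank)
  next
    fix i j assume "i \<in> X \<longleftrightarrow> j \<in> X"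
    then have "fib i = fib j" by (rule X_fib)
    then have eq: "colour_class W (i, i) = colour_class W (j, j)" by (simp add: fib_def)
    have "(adjacency_matrix E ** all_ones) $ i $ i = (adjacency_matrix E ** all_ones) $ j $ j"
      by (rule agree[OF eq mult[OF AW J]])
    then have "complex_of_real (\<Sum>k\<in>UNIV. adj E i k) = complex_of_real (\<Sum>k\<in>UNIV. adj E j k)"
      by (simp add: matrix_matrix_mult_def A all_ones_def)
    then show "(\<Sum>k\<in>UNIV. adj E i k) = (\<Sum>k\<in>UNIV. adj E j k)"
      by (simp only: of_real_eq_iff)
    have block: "(adjacency_matrix E ** (D v0 ** all_ones)) $ i $ i = of_real (\<Sum>k\<in>X. adj E i k)" for i
    proof -
      have "(D v0 ** all_ones) $ k $ i = of_bool (k \<in> X)" for k i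
        by (simp add: DJ X_def)
      then have "(adjacency_matrix E ** (D v0 ** all_ones)) $ i $ i
          = of_real (\<Sum>k\<in>UNIV. adj E i k * of_bool (k \<in> X))"
        unfolding matrix_matrix_mult_def[of "adjacency_matrix E"] by (simp add: A)
      also have "(\<Sum>k\<in>UNIV. adj E i k * of_bool (k \<in> X)) = (\<Sum>k\<in>X. adj E i k)"
        by (intro sum.mono_neutral_cong_right) auto
      finally show ?thesis .
    qed
    have "(adjacency_matrix E ** (D v0 ** all_ones)) $ i $ i
        = (adjacency_matrix E ** (D v0 ** all_ones)) $ j $ j"
      by (rule agree[OF eq mult[OF AW mult[OF DW J]]])
    then show "(\<Sum>k\<in>X. adj E i k) = (\<Sum>k\<in>X. adj E j k)"
      unfolding block by (simp only: of_real_eq_iff)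
  qed
qed

lemma (in quadratic_graph) exists_edge_between:
  assumes "u \<in> X" "v \<notin> X"
  obtains i j where "i \<in> X" "j \<notin> X" "E i j"
proof -
  have "E\<^sup>*\<^sup>* u v" using connected by (simp add: connected_graph_def)
  then have "\<exists>i j. i \<in> X \<and> j \<notin> X \<and> E i j"
    using assms by (induction rule: rtranclp_induct) blast+
  then show thesis using that by blast
qed

text \<open>
  The rank enters twice. It is bounded above by the number of classes of \<open>block_colour\<close> when that
  colouring yields a coherent algebra, which excludes regular graphs and joins. It is bounded below
  by that number whenever \<open>X\<close> is a fibre, which leaves no room for both edges and nonedges inside a fibre
  when both occur between the fibres.
\<close>

lemma (in quadratic_graph) coherent_rank_8_design_split:
  assumes rank: "coherent_rank E = 8"
  obtains X l where "symmetric_design_split X l"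
proof -
  obtain X where X: "X \<noteq> {}" and colours: "card (range (block_colour E X)) \<le> 8"
    and deg: "\<And>i j. i \<in> X \<longleftrightarrow> j \<in> X \<Longrightarrow> (\<Sum>k\<in>UNIV. adj E i k) = (\<Sum>k\<in>UNIV. adj E j k)"
    and degX: "\<And>i j. i \<in> X \<longleftrightarrow> j \<in> X \<Longrightarrow> (\<Sum>k\<in>X. adj E i k) = (\<Sum>k\<in>X. adj E j k)"
    by (rule coherent_rank_8_fibres[OF rank]) (rule that)
  have \<alpha>: "\<alpha> i = \<alpha> j" if "i \<in> X \<longleftrightarrow> j \<in> X" for i j
  proof -
    have "(\<alpha> i)\<^sup>2 = (\<alpha> j)\<^sup>2" using deg[OF that] by (simp add: degree_eq)
    then show ?thesis using \<alpha>_pos[of i] \<alpha>_pos[of j] by (simp add: power2_eq_iff_nonneg)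
  qed
  have nonconst: "\<exists>i j. \<alpha> i \<noteq> \<alpha> j"
  proof (rule ccontr)
    assume "\<nexists>i j. \<alpha> i \<noteq> \<alpha> j"
    then have "coherent_rank E \<le> card (range (block_colour E UNIV))"
      by (intro coherent_rank_join_le) auto
    also have "range (block_colour E UNIV)
        \<subseteq> {(True, True, True, False), (True, True, False, True), (True, True, False, False)}"
      by (auto simp: block_colour_def)
    then have "card (range (block_colour E UNIV))
        \<le> card {(True, True, True, False), (True, True, False, True), (True, True, False, False)}"
      by (intro card_mono) auto
    finally show False using rank by simp
  qed
  obtain x where x: "x \<in> X" using X by blast
  have "\<exists>y. y \<notin> X"
  proof (rule ccontr)
    assume "\<nexists>y. y \<notin> X"
    then show False using nonconst \<alpha> by blast
  qed
  then obtain y where y: "y \<notin> X" by blast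
  have a: "\<alpha> i = \<alpha> x" if "i \<in> X" for i using that x by (intro \<alpha>) simp
  have b': "\<alpha> i = \<alpha> y" if "i \<notin> X" for i using that y by (intro \<alpha>) simp
  have ab: "\<alpha> x \<noteq> \<alpha> y"
  proof
    assume "\<alpha> x = \<alpha> y"
    then have "\<alpha> i = \<alpha> x" for i using a[of i] b'[of i] by (cases "i \<in> X") simp_all
    then show False using nonconst by metis
  qed
  obtain i0 j0 where edge: "i0 \<in> X" "j0 \<notin> X" "E i0 j0"
    using exists_edge_between[OF x y] by blast
  let ?C = "{(True, True, True, False), (True, True, False, True), (True, True, False, False),
      (False, False, True, False), (False, False, False, True), (False, False, False, False),
      (True, False, False, True), (False, True, False, True)}"
  have "\<exists>i j. i \<in> X \<and> j \<notin> X \<and> \<not> E i j"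
  proof (rule ccontr)
    assume "\<not> ?thesis"
    then have join: "E i j" if "i \<in> X" "j \<notin> X" for i j using that by blast
    have sub: "range (block_colour E X) \<subseteq> ?C"
    proof
      fix t assume "t \<in> range (block_colour E X)"
      then obtain i j where "t = (i \<in> X, j \<in> X, i = j, E i j)" by (auto simp: block_colour_def)
      then show "t \<in> ?C"
        using join[of i j] join[of j i] E_commute[of i j]
        by (cases "i \<in> X"; cases "j \<in> X"; cases "i = j"; cases "E i j") simp_all
    qed
    \<comment> \<open>in a join only eight colours are possible, so rank 8 means that all of them occur\<close>
    have "coherent_rank E \<le> card (range (block_colour E X))"
      by (rule coherent_rank_join_le[OF join \<alpha>])
    moreover have "card ?C = 8" by simp
    ultimately have "card ?C \<le> card (range (block_colour E X))" by (simp only: rank)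
    then have C: "range (block_colour E X) = ?C"
      by (intro card_seteq[OF _ sub]) simp_all
    have realised: "\<exists>i j. (i \<in> X, j \<in> X, i = j, E i j) = t" if "t \<in> ?C" for t
    proof -
      have "t \<in> range (block_colour E X)" using that unfolding C .
      then show ?thesis unfolding block_colour_def by auto
    qed
    obtain i1 j1 where e1: "i1 \<in> X" "j1 \<in> X" "E i1 j1"
      using realised[of "(True, True, False, True)"] by auto
    obtain i2 j2 where e2: "i2 \<notin> X" "j2 \<notin> X" "E i2 j2"
      using realised[of "(False, False, False, True)"] by auto
    obtain i3 j3 where e3: "i3 \<in> X" "j3 \<in> X" "i3 \<noteq> j3" "\<not> E i3 j3"
      using realised[of "(True, True, False, False)"] by auto
    have "\<alpha> x = \<alpha> y"
      by (rule join_imp_same_weight[of X "\<alpha> x" "\<alpha> y" i1 j1 i2 j2 i3 j3])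
        (fact join a b' e1 e2 e3)+
    with ab show False by simp
  qed
  then obtain i1 j1 where nonedge: "i1 \<in> X" "j1 \<notin> X" "\<not> E i1 j1" by blast
  have degX': "(\<Sum>k\<in>-X. adj E i k) = (\<Sum>k\<in>-X. adj E j k)" if "i \<in> X \<longleftrightarrow> j \<in> X" for i j
    using deg[OF that] degX[OF that] by (simp add: sum_split[of _ X])
  \<comment> \<open>a singleton part would make the block between the parts constant\<close>
  have two_X: "\<exists>i j. i \<in> X \<and> j \<in> X \<and> i \<noteq> j"
  proof (rule ccontr)
    assume "\<not> ?thesis"
    then have "X = {x}" using x by blast
    then have "adj E j0 x = adj E j1 x" using degX[of j0 j1] edge nonedge by simp
    with \<open>X = {x}\<close> edge nonedge show False by (auto simp: adj_def E_commute)
  qed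
  have two_Y: "\<exists>i j. i \<notin> X \<and> j \<notin> X \<and> i \<noteq> j"
  proof (rule ccontr)
    assume "\<not> ?thesis"
    then have "-X = {y}" using y by blast
    then have "adj E i0 y = adj E i1 y" using degX'[of i0 i1] edge nonedge by simp
    moreover have "j0 = y" "j1 = y" using \<open>-X = {y}\<close> edge nonedge by auto
    ultimately show False using edge nonedge by (simp add: adj_def)
  qed
  have in_range: "(i \<in> X, j \<in> X, i = j, E i j) \<in> range (block_colour E X)" for i j
    by (rule range_eqI[of _ _ "(i, j)"]) (simp add: block_colour_def)
  have cross: "{(True, False, False, True), (True, False, False, False),
      (False, True, False, True), (False, True, False, False)} \<subseteq> range (block_colour E X)"
  proof -
    have "i0 \<noteq> j0" "j0 \<noteq> i0" "i1 \<noteq> j1" "j1 \<noteq> i1" "E j0 i0" "\<not> E j1 i1"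
      using edge nonedge by (auto simp: E_commute[of j0] E_commute[of j1])
    then show ?thesis
      using in_range[of i0 j0] in_range[of j0 i0] in_range[of i1 j1] in_range[of j1 i1] edge nonedge
      by simp
  qed
  have diag: "{(True, True, True, False), (False, False, True, False)} \<subseteq> range (block_colour E X)"
    using in_range[of x x] in_range[of y y] x y by auto
  obtain p p' where "p \<in> X" "p' \<in> X" "p \<noteq> p'" using two_X by blast
  with in_range[of p p'] obtain b where b: "(True, True, False, b) \<in> range (block_colour E X)"
    by simp
  obtain w w' where "w \<notin> X" "w' \<notin> X" "w \<noteq> w'" using two_Y by blast
  with in_range[of w w'] obtain d where d: "(False, False, False, d) \<in> range (block_colour E X)"
    by simp
  have le8: "card S \<le> 8" if "S \<subseteq> range (block_colour E X)" for S
    using card_mono[OF _ that] colours by simp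
  \<comment> \<open>a second colour off the diagonal inside a part would be a ninth colour\<close>
  have not_b: "(True, True, False, \<not> b) \<notin> range (block_colour E X)"
  proof
    assume "(True, True, False, \<not> b) \<in> range (block_colour E X)"
    then have "card {(True, False, False, True), (True, False, False, False),
      (False, True, False, True), (False, True, False, False),
      (True, True, True, False), (False, False, True, False),
      (True, True, False, b), (True, True, False, \<not> b), (False, False, False, d)} \<le> 8"
      using cross diag b d by (intro le8) simp
    then show False by simp
  qed
  have not_d: "(False, False, False, \<not> d) \<notin> range (block_colour E X)"
  proof
    assume "(False, False, False, \<not> d) \<in> range (block_colour E X)"
    then have "card {(True, False, False, True), (True, False, False, False),
      (False, True, False, True), (False, True, False, False),
      (True, True, True, False), (False, False, True, False),
      (True, True, False, b), (False, False, False, \<not> d), (False, False, False, d)} \<le> 8"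
      using cross diag b d by (intro le8) simp
    then show False by simp
  qed
  have u: "adj E i j = of_bool b * of_bool (i \<noteq> j)" if "i \<in> X" "j \<in> X" for i j
    using in_range[of i j] that not_b by (cases "i = j"; cases "E i j"; cases b) (auto simp: adj_def)
  have v: "adj E i j = of_bool d * of_bool (i \<noteq> j)" if "i \<notin> X" "j \<notin> X" for i j
    using in_range[of i j] that not_d by (cases "i = j"; cases "E i j"; cases d) (auto simp: adj_def)
  have r: "(\<Sum>k\<in>-X. adj E i k) = (\<Sum>k\<in>-X. adj E x k)" if "i \<in> X" for i
    using that x by (intro degX') simp
  have c: "(\<Sum>k\<in>X. adj E k j) = (\<Sum>k\<in>X. adj E y k)" if "j \<notin> X" for j
    using degX[of j y] that y by (simp add: adj_commute[of _ j])
  have bool01: "of_bool t \<in> {0, 1 :: real}" for t by simp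
  have "of_bool b = (0 :: real) \<and> of_bool d = (1 :: real) \<and> (\<exists>l. symmetric_design_split X l) \<or>
      of_bool b = (1 :: real) \<and> of_bool d = (0 :: real)"
    by (rule uniform_blocks_imp_design[where X = X and a = "\<alpha> x" and b = "\<alpha> y"
          and r = "\<Sum>k\<in>-X. adj E x k" and c = "\<Sum>k\<in>X. adj E y k"
          and ?i0.0 = i0 and ?j0.0 = j0 and ?i1.0 = i1 and ?j1.0 = j1])
      (fact a b' ab r c bool01 u v edge nonedge)+
  then consider l where "symmetric_design_split X l" | "b" "\<not> d" by auto
  then show thesis
  proof cases
    case 1
    then show thesis by (rule that)
  next
    case 2
    have a': "\<alpha> i = \<alpha> y" if "i \<in> -X" for i using b' that by simp
    have b'': "\<alpha> i = \<alpha> x" if "i \<notin> -X" for i using a that by simp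
    have r': "(\<Sum>k\<in>- (-X). adj E i k) = (\<Sum>k\<in>X. adj E y k)" if "i \<in> -X" for i
      using c[of i] that by (simp add: adj_commute[of _ i])
    have c': "(\<Sum>k\<in>-X. adj E k j) = (\<Sum>k\<in>-X. adj E x k)" if "j \<notin> -X" for j
      using r[of j] that by (simp add: adj_commute[of _ j])
    have u': "adj E i j = of_bool d * of_bool (i \<noteq> j)" if "i \<in> -X" "j \<in> -X" for i j
      using v that by simp
    have v': "adj E i j = of_bool b * of_bool (i \<noteq> j)" if "i \<notin> -X" "j \<notin> -X" for i j
      using u that by simp
    have edge': "j0 \<in> -X" "i0 \<notin> -X" "E j0 i0" "j1 \<in> -X" "i1 \<notin> -X" "\<not> E j1 i1"
      using edge nonedge E_commute[of i0 j0] E_commute[of i1 j1] by simp_all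
    have "of_bool d = (0 :: real) \<and> of_bool b = (1 :: real) \<and> (\<exists>l. symmetric_design_split (-X) l) \<or>
        of_bool d = (1 :: real) \<and> of_bool b = (0 :: real)"
      by (rule uniform_blocks_imp_design[where X = "-X" and a = "\<alpha> y" and b = "\<alpha> x"
            and r = "\<Sum>k\<in>X. adj E y k" and c = "\<Sum>k\<in>-X. adj E x k"
            and ?i0.0 = j0 and ?j0.0 = i0 and ?i1.0 = j1 and ?j1.0 = i1])
        (fact a' b'' ab[symmetric] r' c' bool01 u' v' edge')+
    with 2 obtain l where "symmetric_design_split (-X) l" by auto
    then show thesis by (rule that)
  qed
qed

section \<open>Construction of the design\<close>

context quadratic_graph
begin

text \<open>
  The points are numbered by natural numbers through \<open>h\<close>, and a vertex \<open>j\<close> of the clique becomes the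
  block \<open>B j\<close> of the numbers of its neighbours in \<open>X\<close>.
\<close>

lemma design_split_conclusion:
  assumes split: "symmetric_design_split X l"
  shows "\<exists>(P::nat set) (\<B>::nat set set) (f :: nat + nat set \<Rightarrow> 'v).
    symmetric_two_design P \<B> (l ^ 3 - l + 1) (l ^ 2) l \<and>
    bij_betw f (P <+> \<B>) UNIV \<and>
    (\<forall>s \<in> P <+> \<B>. \<forall>t \<in> P <+> \<B>.
       adjacency_matrix E $ f s $ f t =
         block_matrix
           (\<lambda>_ _. 0)                          incidence_matrix
           (\<lambda>j i. incidence_matrix i j)       (\<lambda>j j'. 1 - (if j = j' then 1 else 0))
           s t)"
proof -
  let ?n = "l ^ 3 - l + 1"
  have cardX: "card X = ?n" and cardY: "card (-X) = ?n" and l: "1 < l"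
    and EX: "\<And>i j. i \<in> X \<Longrightarrow> j \<in> X \<Longrightarrow> \<not> E i j"
    and EY: "\<And>i j. i \<in> -X \<Longrightarrow> j \<in> -X \<Longrightarrow> E i j \<longleftrightarrow> i \<noteq> j"
    and size: "\<And>j. j \<in> -X \<Longrightarrow> card {i\<in>X. E i j} = l\<^sup>2"
    and pairs: "\<And>i j. i \<in> X \<Longrightarrow> j \<in> X \<Longrightarrow> i \<noteq> j \<Longrightarrow> card {k\<in>-X. E i k \<and> E j k} = l"
    and meet: "\<And>i j. i \<in> -X \<Longrightarrow> j \<in> -X \<Longrightarrow> i \<noteq> j \<Longrightarrow> card {k\<in>X. E k i \<and> E k j} = l"
    using split by (simp_all add: symmetric_design_split_def)
  obtain h where h: "bij_betw h {..<?n} X"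
    using ex_bij_betw_nat_finite[of X] cardX by (auto simp: atLeast0LessThan)
  define P where "P = {..<?n}"
  have h: "bij_betw h P X" using h by (simp add: P_def)
  define B where "B j = {p\<in>P. E (h p) j}" for j
  define \<B> where "\<B> = B ` (-X)"
  have hX: "h p \<in> X" if "p \<in> P" for p using h that by (auto simp: bij_betw_def)
  have inj_h: "inj_on h S" if "S \<subseteq> P" for S
    using h that by (auto simp: bij_betw_def intro: inj_on_subset)
  have card_h: "card {p\<in>P. Q (h p)} = card {i\<in>X. Q i}" for Q
  proof -
    have "h ` {p\<in>P. Q (h p)} = {i\<in>X. Q i}" using h by (auto simp: bij_betw_def)
    then show ?thesis using card_image[OF inj_h[of "{p\<in>P. Q (h p)}"]] by auto
  qed
  have card_B: "card (B j) = l\<^sup>2" if "j \<in> -X" for j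
    using card_h[of "\<lambda>i. E i j"] size[OF that] by (simp add: B_def)
  have card_B_Int: "card (B i \<inter> B j) = l" if "i \<in> -X" "j \<in> -X" "i \<noteq> j" for i j
  proof -
    have "B i \<inter> B j = {p\<in>P. E (h p) i \<and> E (h p) j}" by (auto simp: B_def)
    then show ?thesis using card_h[of "\<lambda>k. E k i \<and> E k j"] meet[OF that] by simp
  qed
  have inj_B: "inj_on B (-X)"
  proof (rule inj_onI, rule ccontr)
    fix i j assume ij: "i \<in> -X" "j \<in> -X" "B i = B j" "i \<noteq> j"
    then have "l\<^sup>2 = l" using card_B_Int[of i j] card_B[of j] by simp
    with l show False by (simp add: power2_eq_square)
  qed
  have bij_B: "bij_betw B (-X) \<B>" using inj_B by (simp add: \<B>_def bij_betw_def)
  have "two_design P \<B> ?n (l\<^sup>2) l"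
    unfolding two_design_def
  proof (intro conjI ballI impI)
    show "finite P" "card P = ?n" by (simp_all add: P_def)
    show "C \<subseteq> P" "card C = l\<^sup>2" if "C \<in> \<B>" for C
      using that card_B by (auto simp: \<B>_def B_def)
    fix p p' assume p: "p \<in> P" "p' \<in> P" "p \<noteq> p'"
    have "{C\<in>\<B>. p \<in> C \<and> p' \<in> C} = B ` {k\<in>-X. E (h p) k \<and> E (h p') k}"
      using p by (auto simp: \<B>_def B_def)
    then have "card {C\<in>\<B>. p \<in> C \<and> p' \<in> C} = card {k\<in>-X. E (h p) k \<and> E (h p') k}"
      by (simp only:) (intro card_image inj_on_subset[OF inj_B], blast)
    also have "\<dots> = l"
      using p hX inj_h[of P] by (intro pairs) (auto simp: inj_on_def)
    finally show "card {C\<in>\<B>. p \<in> C \<and> p' \<in> C} = l" .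
  qed
  moreover have "card \<B> = ?n" using bij_betw_same_card[OF bij_B] cardY by simp
  moreover have "\<forall>C\<in>\<B>. \<forall>C'\<in>\<B>. C \<noteq> C' \<longrightarrow> card (C \<inter> C') = l"
    using card_B_Int by (auto simp: \<B>_def)
  ultimately have "symmetric_two_design P \<B> ?n (l\<^sup>2) l"
    by (auto simp: symmetric_two_design_def)
  moreover define g where "g = inv_into (-X) B"
  have bij_g: "bij_betw g \<B> (-X)" unfolding g_def by (rule bij_betw_inv_into[OF bij_B])
  have gX: "g C \<in> -X" if "C \<in> \<B>" for C using bij_g that by (auto simp: bij_betw_def)
  have Bg: "B (g C) = C" if "C \<in> \<B>" for C
    using bij_betw_inv_into_right[OF bij_B that] by (simp add: g_def)
  define f where "f = case_sum h g"
  have "bij_betw f (P <+> \<B>) UNIV"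
    unfolding bij_betw_def
  proof
    show "inj_on f (P <+> \<B>)"
    proof (rule inj_onI)
      fix s t assume st: "s \<in> P <+> \<B>" "t \<in> P <+> \<B>" "f s = f t"
      have hg: "h p \<noteq> g C" if "p \<in> P" "C \<in> \<B>" for p C using hX[OF that(1)] gX[OF that(2)] by auto
      have hh: "p = p'" if "h p = h p'" "p \<in> P" "p' \<in> P" for p p'
        using inj_h[of P] that by (simp add: inj_on_eq_iff)
      have gg: "C = C'" if "g C = g C'" "C \<in> \<B>" "C' \<in> \<B>" for C C'
        using bij_g that by (auto simp: bij_betw_def dest: inj_onD)
      show "s = t"
        using st by (elim PlusE; simp add: f_def; metis hg hh gg)
    qed
    have "f ` (P <+> \<B>) = h ` P \<union> g ` \<B>" by (force simp: f_def)
    also have "\<dots> = UNIV" using h bij_g by (auto simp: bij_betw_def)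
    finally show "f ` (P <+> \<B>) = UNIV" .
  qed
  moreover have "adjacency_matrix E $ f s $ f t = block_matrix (\<lambda>_ _. 0) incidence_matrix
      (\<lambda>j i. incidence_matrix i j) (\<lambda>j j'. 1 - (if j = j' then 1 else 0)) s t"
    if "s \<in> P <+> \<B>" "t \<in> P <+> \<B>" for s t
  proof -
    have inc: "E (h p) (g C) \<longleftrightarrow> p \<in> C" if "p \<in> P" "C \<in> \<B>" for p C
      using Bg[OF that(2)] that(1) by (auto simp: B_def)
    have gg: "E (g C) (g C') \<longleftrightarrow> C \<noteq> C'" if "C \<in> \<B>" "C' \<in> \<B>" for C C'
      using EY[OF gX gX] that Bg by metis
    have hh: "\<not> E (h p) (h p')" if "p \<in> P" "p' \<in> P" for p p'
      using EX[OF hX hX] that by blast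
    have gh: "E (g C) (h p) \<longleftrightarrow> p \<in> C" if "p \<in> P" "C \<in> \<B>" for p C
      using inc[OF that] E_commute by blast
    show ?thesis
      using that
      by (cases s; cases t) (auto simp: f_def adjacency_matrix_def incidence_matrix_def hh inc gh gg)
  qed
  ultimately show ?thesis by blast
qed

end

theorem theorem4p3:
  fixes E :: "'v::finite \<Rightarrow> 'v \<Rightarrow> bool"
  assumes "E \<in> G3" and "coherent_rank E = 8"
  shows "\<exists>(l::nat) (P::nat set) (\<B>::nat set set) (f :: nat + nat set \<Rightarrow> 'v).
    symmetric_two_design P \<B> (l ^ 3 - l + 1) (l ^ 2) l \<and>
    bij_betw f (P <+> \<B>) UNIV \<and>
    (\<forall>s \<in> P <+> \<B>. \<forall>t \<in> P <+> \<B>.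
       adjacency_matrix E $ f s $ f t =
         block_matrix
           (\<lambda>_ _. 0)                          incidence_matrix
           (\<lambda>j i. incidence_matrix i j)       (\<lambda>j j'. 1 - (if j = j' then 1 else 0))
           s t)"
proof -
  obtain \<alpha> s q where \<alpha>: "\<And>i. 0 < \<alpha> i"
    "\<And>i j. (\<Sum>k\<in>UNIV. adj E i k * adj E k j) = s * adj E i j - q * of_bool (i = j) + \<alpha> i * \<alpha> j"
    by (rule three_eigenvalues_quadratic[OF assms(1)]) (rule that)
  interpret quadratic_graph E s q \<alpha>
    using assms(1) \<alpha> by unfold_locales (auto simp: G3_def)
  obtain X l where "symmetric_design_split X l"
    using coherent_rank_8_design_split[OF assms(2)] by blast
  from design_split_conclusion[OF this] show ?thesis by blast
qed

end
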